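(* Let $\lambda\in\mathbb{C}$ with $\operatorname{Re}\lambda>0$ and $\operatorname{Im}\lambda>0$. Then, as $x\to\infty$, $$\frac{y_0(x;\lambda)}{y_1(x;\lambda)}=-m(\lambda)\left[1+o\left(e^{-\operatorname{Im}\{4\sqrt{2\lambda}/5\}\,x^{5/2}}\right)\right],$$ where $\sqrt{\cdot}$ is the principal branch. That is, the relative error in approximating $m(\lambda)$ by $-y_0(x;\lambda)/y_1(x;\lambda)$ decays faster than $\exp\left(-\operatorname{Im}\{4\sqrt{2\lambda}/5\}\,x^{5/2}\right)$.
   Context: Let $\operatorname{erf}(x)=\frac{2}{\sqrt\pi}\int_0^x e^{-s^2}\,ds$, $\Psi(x)=\frac{1}{2x^3}\left[\operatorname{erf}(x)-\frac{2}{\sqrt\pi}xe^{-x^2}\right]$ (with $\Psi(0)=\frac{2}{3\sqrt\pi}$), and $w(x)=x^2e^{-x^2}$. For $\lambda\in\mathbb{C}$ consider the ODE $-(\Psi w u')'=\lambda w u$ on $(0,\infty)$. To a solution $u$ associate $y(x)=xe^{-x^2/2}u(x)$ and $z(x)=\Psi(x)x^2e^{-x^2/2}u'(x)$; all such $(y,z)$ extend analytically to a neighborhood of $x=0$. Let $u_1(x;\lambda)$ be the solution that is bounded near $x=0$ with $u_1(0;\lambda)=1$ (its pair $(y_1,z_1)$ is odd in $x$), and let $u_0(x;\lambda)$ be the solution whose pair $(y_0,z_0)$ is even in $x$ with $y_0(0)=\frac{3\sqrt\pi}{2}$, $z_0(0)=-1$; then $\Psi w(u_0u_1'-u_1u_0')\equiv1$.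 For $\lambda\in\mathbb{C}\setminus\mathbb{R}$ the Titchmarsh--Weyl $m$-function $m(\lambda)$ is the unique complex number such that $u_0(\cdot;\lambda)+m(\lambda)u_1(\cdot;\lambda)\in L^2((0,\infty);w\,dx)$. *)

theory Defs
  imports "HOL-Complex_Analysis.Complex_Analysis" "HOL-Library.Landau_Symbols"
begin

text \<open>The oriented interval integral, so that \<open>erf\<close> is odd.\<close>

definition erf :: "real \<Rightarrow> real" where
  "erf x = 2 / sqrt pi * (LBINT s=0..x. exp (- (s\<^sup>2)))"

definition Psi :: "real \<Rightarrow> real" where
  "Psi x = (if x = 0 then 2 / (3 * sqrt pi)
            else 1 / (2 * x ^ 3) * (erf x - 2 / sqrt pi * x * exp (- (x\<^sup>2))))"

definition wgt :: "real \<Rightarrow> real" where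
  "wgt x = x\<^sup>2 * exp (- (x\<^sup>2))"

text \<open>Classical solutions of \<open>- (\<Psi> w u')' = \<lambda> w u\<close> on the open half-line. Only the values
  of \<open>u\<close> at positive arguments matter.\<close>

definition is_solution :: "complex \<Rightarrow> (real \<Rightarrow> complex) \<Rightarrow> bool" where
  "is_solution lam u \<longleftrightarrow>
     (\<forall>x>0. u differentiable (at x) \<and>
        (\<lambda>t. of_real (Psi t * wgt t) * vector_derivative u (at t)) differentiable (at x) \<and>
        - vector_derivative (\<lambda>t. of_real (Psi t * wgt t) * vector_derivative u (at t)) (at x)
          = lam * of_real (wgt x) * u x)"

definition y_of :: "(real \<Rightarrow> complex) \<Rightarrow> real \<Rightarrow> complex" where
  "y_of u x = of_real (x * exp (- (x\<^sup>2) / 2)) * u x"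

definition z_of :: "(real \<Rightarrow> complex) \<Rightarrow> real \<Rightarrow> complex" where
  "z_of u x = of_real (Psi x * x\<^sup>2 * exp (- (x\<^sup>2) / 2)) * vector_derivative u (at x)"

text \<open>\<open>F\<close> is an analytic extension to a complex neighbourhood of \<open>0\<close> of the function \<open>f\<close>,
  given on the positive reals.\<close>

definition analytic_extension_at_0 :: "(real \<Rightarrow> complex) \<Rightarrow> (complex \<Rightarrow> complex) \<Rightarrow> bool" where
  "analytic_extension_at_0 f F \<longleftrightarrow>
     F analytic_on {0} \<and> (\<forall>\<^sub>F x in at_right 0. F (of_real x) = f x)"

definition even_near_0 :: "(complex \<Rightarrow> complex) \<Rightarrow> bool" where
  "even_near_0 F \<longleftrightarrow> (\<forall>\<^sub>F s in nhds 0. F (- s) = F s)"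

text \<open>The value at the singular endpoint \<open>0\<close> is understood as the limit from the right.\<close>

definition is_u1 :: "complex \<Rightarrow> (real \<Rightarrow> complex) \<Rightarrow> bool" where
  "is_u1 lam u \<longleftrightarrow>
     is_solution lam u \<and> Bfun u (at_right 0) \<and> (u \<longlongrightarrow> 1) (at_right 0)"

definition is_u0 :: "complex \<Rightarrow> (real \<Rightarrow> complex) \<Rightarrow> bool" where
  "is_u0 lam u \<longleftrightarrow>
     is_solution lam u \<and>
     (\<exists>Y Z. analytic_extension_at_0 (y_of u) Y \<and> analytic_extension_at_0 (z_of u) Z \<and>
            even_near_0 Y \<and> even_near_0 Z \<and>
            Y 0 = of_real (3 * sqrt pi / 2) \<and> Z 0 = -1)"

definition in_weighted_L2 :: "(real \<Rightarrow> complex) \<Rightarrow> bool" where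
  "in_weighted_L2 f \<longleftrightarrow>
     set_borel_measurable lborel {0<..} f \<and>
     set_integrable lborel {0<..} (\<lambda>x. (cmod (f x))\<^sup>2 * wgt x)"

text \<open>The value \<open>m(\<lambda>)\<close> of the Titchmarsh--Weyl function, when \<open>u0\<close> and \<open>u1\<close> are the two
  distinguished solutions for \<open>\<lambda>\<close>.\<close>

definition weyl_m :: "(real \<Rightarrow> complex) \<Rightarrow> (real \<Rightarrow> complex) \<Rightarrow> complex" where
  "weyl_m u0 u1 = (THE m. in_weighted_L2 (\<lambda>x. u0 x + m * u1 x))"

end

theory Submission
  imports Defs "HOL-Probability.Distributions"
begin

text \<open>
  Write \<open>P = \<Psi> w u'\<close>. By Green's identity the flux \<open>Im (P cnj u)\<close> has derivative
  \<open>- Im \<lambda> w |u|\<^sup>2\<close>; it tends to \<open>0\<close> at \<open>0\<close> for \<open>u\<^sub>1\<close> and, by evenness of \<open>(y\<^sub>0, z\<^sub>0)\<close>, to \<open>Im m\<close>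
  for \<open>u\<^sub>0 + m u\<^sub>1\<close>. Negativity of the flux of \<open>u\<^sub>1\<close> confines its logarithmic derivative to a
  half-plane, so \<open>u\<^sub>1\<close> is bounded by its growing WKB amplitude, whose growth then carries over to
  \<open>u\<^sub>1\<close> itself. As \<open>(u\<^sub>0/u\<^sub>1)' = - 1 / (\<Psi> w u\<^sub>1\<^sup>2)\<close>, the quotient \<open>u\<^sub>0/u\<^sub>1\<close> converges to some \<open>L\<close>
  at a rate controlled by the growth of \<open>u\<^sub>1\<close>. The phase \<open>\<phi>\<^sup>2 \<approx> 2\<lambda>x\<^sup>3 - x\<^sup>2\<close> gives, besides the leading term
  \<open>x^(5/2)\<close>, a gain of order \<open>x^(3/2)\<close> in the exponent, which is why the error is a little \<open>o\<close>.
  The solutions \<open>u\<^sub>0 - (u\<^sub>0/u\<^sub>1)(X) u\<^sub>1\<close> vanish at \<open>X\<close> and have nonnegative flux on \<open>(0, X)\<close>; in the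
  limit this puts \<open>u\<^sub>0 - L u\<^sub>1\<close> in \<open>L\<^sup>2\<close>, so \<open>m(\<lambda>) = - L\<close>.
\<close>

section \<open>The error function and the coefficient\<close>

text \<open>For positive \<open>x\<close> this is \<open>2 * x ^ 3 * Psi x\<close>. It is the
  distribution function of the Maxwell speed law: its derivative is a multiple of
  \<open>wgt\<close>, and it increases from 0 to 1 on the half-line.\<close>

definition erf_defect :: "real \<Rightarrow> real" where
  "erf_defect x = erf x - 2 / sqrt pi * x * exp (- (x\<^sup>2))"

lemma erf_0: "erf 0 = 0"
  unfolding erf_def zero_ereal_def by simp

lemma erf_DERIV: "(erf has_field_derivative 2 / sqrt pi * exp (- (x\<^sup>2))) (at x)"
proof -
  \<comment> \<open>The interval is chosen to contain the base point 0 and to have \<open>x\<close>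
    in its interior, so that the derivative within it becomes a full derivative.\<close>
  have "((\<lambda>u. LBINT y=ereal 0..u. exp (- (y\<^sup>2))) has_vector_derivative exp (- (x\<^sup>2))) 
      (at x within {-\<bar>x\<bar>-1..\<bar>x\<bar>+1})"
    by (rule interval_integral_FTC2) (auto intro!: continuous_intros)
  hence "((\<lambda>u. LBINT y=ereal 0..u. exp (- (y\<^sup>2))) has_vector_derivative exp (- (x\<^sup>2))) 
      (at x within {-\<bar>x\<bar>-1<..<\<bar>x\<bar>+1})"
    by (rule has_vector_derivative_within_subset) auto
  hence "((\<lambda>u. LBINT y=ereal 0..u. exp (- (y\<^sup>2))) has_vector_derivative exp (- (x\<^sup>2))) (at x)"
    by (subst (asm) at_within_open) auto
  hence "((\<lambda>u. LBINT y=ereal 0..u. exp (- (y\<^sup>2))) has_field_derivative exp (- (x\<^sup>2))) (at x)"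
    by (simp add: has_real_derivative_iff_has_vector_derivative)
  from DERIV_cmult[OF this, of "2 / sqrt pi"] show ?thesis
    by (simp add: erf_def [abs_def] zero_ereal_def)
qed

lemma erf_tendsto: "(erf \<longlongrightarrow> 1) at_top"
proof -
  have int: "set_integrable lborel {0..} (\<lambda>x::real. exp (- (x\<^sup>2)))"
    and val: "(LBINT x:{0..}. exp (- (x\<^sup>2)) :: real) = sqrt pi / 2"
    using gaussian_moment_0 
    by (auto simp: set_integrable_def set_lebesgue_integral_def has_bochner_integral_iff)
  have "((\<lambda>t. LBINT x:{0..t}. exp (- (x\<^sup>2)) :: real) \<longlongrightarrow> (LBINT x:{0..}. exp (- (x\<^sup>2)) :: real)) at_top"
    by (rule tendsto_set_lebesgue_integral_at_top) (use int in auto)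
  hence "((\<lambda>t. 2 / sqrt pi * (LBINT x:{0..t}. exp (- (x\<^sup>2)) :: real)) \<longlongrightarrow> 2 / sqrt pi * (sqrt pi / 2)) at_top"
    unfolding val by (intro tendsto_intros)
  moreover have "\<forall>\<^sub>F t in at_top. 2 / sqrt pi * (LBINT x:{0..t}. exp (- (x\<^sup>2)) :: real) = erf t"
    using eventually_ge_at_top[of 0]
    by eventually_elim (simp add: erf_def zero_ereal_def interval_integral_Icc)
  ultimately show ?thesis by (simp add: tendsto_cong)
qed

lemma erf_defect_DERIV: "(erf_defect has_field_derivative 4 / sqrt pi * wgt x) (at x)"
  unfolding erf_defect_def wgt_def
  by (rule erf_DERIV derivative_eq_intros refl | simp)+ (simp add: field_simps power2_eq_square)

lemma erf_defect_0 [simp]: "erf_defect 0 = 0" by (simp add: erf_defect_def erf_0)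

lemma wgt_pos: "x > 0 \<Longrightarrow> wgt x > 0"
  and wgt_nonneg: "wgt x \<ge> 0"
  and wgt_le: "wgt x \<le> x\<^sup>2"
  by (auto simp: wgt_def mult_left_le)

lemma erf_defect_strict_mono: assumes "x < y" "0 \<le> x" shows "erf_defect x < erf_defect y"
proof (rule DERIV_pos_imp_increasing_open [OF assms(1)])
  fix t assume "x < t" "t < y" 
  thus "\<exists>D. (erf_defect has_field_derivative D) (at t) \<and> 0 < D" 
    using assms by (intro exI[of _ "4 / sqrt pi * wgt t"] conjI erf_defect_DERIV) (auto simp: wgt_pos)
qed (auto intro!: DERIV_continuous_on erf_defect_DERIV[THEN has_field_derivative_at_within])

lemma erf_defect_pos: "x > 0 \<Longrightarrow> erf_defect x > 0"
  using erf_defect_strict_mono[of 0 x] by simp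

lemma erf_defect_tendsto: "(erf_defect \<longlongrightarrow> 1) at_top"
proof -
  have "((\<lambda>x::real. 2 / sqrt pi * x * exp (- (x\<^sup>2))) \<longlongrightarrow> 0) at_top" 
    by real_asymp
  from tendsto_diff[OF erf_tendsto this] show ?thesis by (simp add: erf_defect_def[abs_def])
qed

lemma erf_defect_le_1: assumes "x \<ge> 0" shows "erf_defect x \<le> 1"
proof (rule tendsto_lowerbound[OF erf_defect_tendsto])
  show "\<forall>\<^sub>F y in at_top. erf_defect x \<le> erf_defect y"
    using eventually_gt_at_top[of x] by eventually_elim (use assms in \<open>auto intro: less_imp_le erf_defect_strict_mono\<close>)
qed auto

text \<open>\<open>erf_defect x + 1/x\<^sup>2\<close> is eventually decreasing with limit 1.\<close>

lemma erf_defect_ge: "\<forall>\<^sub>F x in at_top. erf_defect x \<ge> 1 - 1 / x\<^sup>2"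
proof -
  have "\<forall>\<^sub>F x in at_top. 4 / sqrt pi * wgt x \<le> 2 / x ^ 3 \<and> x > 0"
    unfolding wgt_def by (intro eventually_conj) real_asymp+
  then obtain X where X: "\<And>x. x \<ge> X \<Longrightarrow> 4 / sqrt pi * wgt x \<le> 2 / x ^ 3 \<and> x > 0"
    unfolding eventually_at_top_linorder by auto
  have lim: "((\<lambda>x. erf_defect x + 1 / x\<^sup>2) \<longlongrightarrow> 1) at_top"
  proof -
    have "((\<lambda>x::real. 1 / x\<^sup>2) \<longlongrightarrow> 0) at_top" by real_asymp
    from tendsto_add[OF erf_defect_tendsto this] show ?thesis by simp
  qed
  have dec: "erf_defect y + 1 / y\<^sup>2 \<le> erf_defect x + 1 / x\<^sup>2" if "X \<le> x" "x \<le> y" for x y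
  proof (rule DERIV_nonpos_imp_nonincreasing[OF that(2)])
    fix t assume "x \<le> t" "t \<le> y"
    hence t: "t > 0" "4 / sqrt pi * wgt t \<le> 2 / t ^ 3" using X[of t] that by auto
    have "((\<lambda>x. erf_defect x + 1 / x\<^sup>2) has_field_derivative (4 / sqrt pi * wgt t - 2 / t ^ 3)) (at t)"
    proof -
      have "((\<lambda>x. 1 / x\<^sup>2) has_field_derivative - 2 / t ^ 3) (at t)"
        using t by (auto intro!: derivative_eq_intros simp: field_simps power2_eq_square power3_eq_cube)
      from DERIV_add[OF erf_defect_DERIV this] show ?thesis by simp
    qed
    thus "\<exists>D. ((\<lambda>a. erf_defect a + 1 / a\<^sup>2) has_real_derivative D) (at t) \<and> D \<le> 0"
      using t by (intro exI conjI) auto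
  qed
  have "1 \<le> erf_defect x + 1 / x\<^sup>2" if "X \<le> x" for x
  proof (rule tendsto_upperbound[OF lim])
    show "\<forall>\<^sub>F y in at_top. erf_defect y + 1 / y\<^sup>2 \<le> erf_defect x + 1 / x\<^sup>2"
      using eventually_ge_at_top[of x] by eventually_elim (use dec that in auto)
  qed auto
  thus ?thesis unfolding eventually_at_top_linorder by (intro exI[of _ X]) (auto simp: algebra_simps)
qed

text \<open>By the mean value theorem, since \<open>wgt t\<close> is at most the square of
  \<open>x\<close> for \<open>t\<close> between 0 and \<open>x\<close>. The cubic order compensates
  the singular factor in \<open>Psi\<close> at the origin.\<close>

lemma erf_defect_le_cube: assumes "x \<ge> 0" shows "erf_defect x \<le> 4 / sqrt pi * x ^ 3"
proof (cases "x = 0")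
  case False
  with assms obtain t where t: "0 < t" "t < x" "erf_defect x - erf_defect 0 = (x - 0) * (4 / sqrt pi * wgt t)"
    using MVT2[of 0 x erf_defect "\<lambda>t. 4 / sqrt pi * wgt t"] erf_defect_DERIV by force
  have "wgt t \<le> x\<^sup>2" using wgt_le[of t] t power_mono[of t x 2] by linarith
  hence "x * (4 / sqrt pi * wgt t) \<le> x * (4 / sqrt pi * x\<^sup>2)"
    using assms by (intro mult_left_mono) auto
  thus ?thesis using t(3) by (simp add: power2_eq_square power3_eq_cube mult_ac)
qed auto

section \<open>The coefficient of the flux\<close>

definition flux_coeff :: "real \<Rightarrow> real" where "flux_coeff x = Psi x * wgt x"

lemma Psi_erf_defect: "x > 0 \<Longrightarrow> Psi x = erf_defect x / (2 * x ^ 3)"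
  by (simp add: Psi_def erf_defect_def)

lemma flux_coeff_erf_defect: "x > 0 \<Longrightarrow> flux_coeff x = erf_defect x * exp (- (x\<^sup>2)) / (2 * x)"
  by (simp add: flux_coeff_def Psi_erf_defect wgt_def field_simps power2_eq_square power3_eq_cube)

lemma flux_coeff_pos: "x > 0 \<Longrightarrow> flux_coeff x > 0"
  by (simp add: flux_coeff_erf_defect erf_defect_pos)

text \<open>Since \<open>u' = P / flux_coeff\<close>, an upper bound for the coefficient is a lower
  bound for \<open>u'\<close> near the singular endpoint, as long as \<open>P\<close> stays away
  from 0.\<close>

lemma flux_coeff_le: assumes "x > 0" shows "flux_coeff x \<le> 2 / sqrt pi * x\<^sup>2"
proof -
  have "erf_defect x * exp (- (x\<^sup>2)) \<le> (4 / sqrt pi * x ^ 3) * 1"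
    using erf_defect_le_cube[of x] erf_defect_pos[of x] assms by (intro mult_mono) auto
  hence "erf_defect x * exp (- (x\<^sup>2)) / (2 * x) \<le> (4 / sqrt pi * x ^ 3) * 1 / (2 * x)" 
    using assms by (intro divide_right_mono) auto
  also have "\<dots> = 2 / sqrt pi * x\<^sup>2" using assms by (simp add: field_simps power2_eq_square power3_eq_cube)
  finally show ?thesis using assms by (simp add: flux_coeff_erf_defect)
qed

section \<open>Solutions as first-order systems and their behaviour at the origin\<close>

text \<open>The flux \<open>P\<close> is an unknown of its own: the equation becomes a linear
  first-order system to which the derivative rules apply directly, and linear combinations of pairs
  are again pairs.\<close>

definition solution_pair :: "complex \<Rightarrow> (real \<Rightarrow> complex) \<Rightarrow> (real \<Rightarrow> complex) \<Rightarrow> bool" where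
  "solution_pair lam u P \<longleftrightarrow> (\<forall>x>0. (u has_vector_derivative P x / of_real (flux_coeff x)) (at x) \<and>
     (P has_vector_derivative - lam * of_real (wgt x) * u x) (at x))"

lemma solution_pairD:
  assumes "solution_pair lam u P" "x > 0"
  shows "(u has_vector_derivative P x / of_real (flux_coeff x)) (at x)"
    and "(P has_vector_derivative - lam * of_real (wgt x) * u x) (at x)"
  using assms by (auto simp: solution_pair_def)

lemma is_solution_imp_solution_pair:
  assumes "is_solution lam u"
  shows "solution_pair lam u (\<lambda>x. of_real (flux_coeff x) * vector_derivative u (at x))"
  unfolding solution_pair_def
proof (intro allI impI conjI)
  fix x :: real assume x: "x > 0"
  have 1: "u differentiable (at x)" and
    2: "(\<lambda>t. of_real (flux_coeff t) * vector_derivative u (at t)) differentiable (at x)" and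
    3: "- vector_derivative (\<lambda>t. of_real (flux_coeff t) * vector_derivative u (at t)) (at x)
          = lam * of_real (wgt x) * u x"
    using assms x unfolding is_solution_def flux_coeff_def by auto
  show "(u has_vector_derivative of_real (flux_coeff x) * vector_derivative u (at x) / of_real (flux_coeff x)) (at x)"
    using 1 flux_coeff_pos[OF x] by (simp add: vector_derivative_works)
  have "vector_derivative (\<lambda>t. of_real (flux_coeff t) * vector_derivative u (at t)) (at x)
          = - lam * of_real (wgt x) * u x" using 3 by (metis minus_minus mult_minus_left)
  thus "((\<lambda>t. of_real (flux_coeff t) * vector_derivative u (at t)) has_vector_derivative 
          - lam * of_real (wgt x) * u x) (at x)"
    using 2 by (metis vector_derivative_works)
qed

lemma solution_pair_add_mult:
  assumes "solution_pair lam u P" "solution_pair lam v Q"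
  shows "solution_pair lam (\<lambda>x. u x + m * v x) (\<lambda>x. P x + m * Q x)"
  unfolding solution_pair_def
proof (intro allI impI conjI)
  fix x :: real assume x: "x > 0"
  note d = solution_pairD[OF assms(1) x] solution_pairD[OF assms(2) x]
  show "((\<lambda>x. u x + m * v x) has_vector_derivative (P x + m * Q x) / of_real (flux_coeff x)) (at x)"
    by (rule has_vector_derivative_eq_rhs, (rule derivative_intros d)+) (simp add: add_divide_distrib)
  show "((\<lambda>x. P x + m * Q x) has_vector_derivative - lam * of_real (wgt x) * (u x + m * v x)) (at x)"
    by (rule has_vector_derivative_eq_rhs, (rule derivative_intros d)+) (simp add: algebra_simps)
qed

lemma solution_pair_isCont:
  assumes "solution_pair lam u P" "x > 0"
  shows "isCont u x" "isCont P x"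
  using solution_pairD[OF assms] has_vector_derivative_continuous by blast+

text \<open>The derivative of \<open>P * cnj u\<close> is
  \<open>|P|^2 / flux_coeff - lam * wgt * |u|^2\<close>. The first term is real, so the imaginary
  part only sees the second: the loss of flux measures the weighted mass of
  \<open>u\<close>.\<close>

lemma green_identity:
  assumes "solution_pair lam u P" "x > 0"
  shows "((\<lambda>x. Im (P x * cnj (u x))) has_real_derivative - Im lam * (wgt x * (cmod (u x))\<^sup>2)) (at x)"
proof -
  note d = solution_pairD[OF assms]
  have "((\<lambda>x. P x * cnj (u x)) has_vector_derivative 
     P x * cnj (P x / of_real (flux_coeff x)) + - lam * of_real (wgt x) * u x * cnj (u x)) (at x)"
    by (rule derivative_intros d has_vector_derivative_cnj)+
  hence "((\<lambda>x. Im (P x * cnj (u x))) has_vector_derivative 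
     Im (P x * cnj (P x / of_real (flux_coeff x)) + - lam * of_real (wgt x) * u x * cnj (u x))) (at x)"
    by (rule bounded_linear.has_vector_derivative[OF bounded_linear_Im])
  moreover have "P x * cnj (P x / of_real (flux_coeff x)) + - lam * of_real (wgt x) * u x * cnj (u x) =
      of_real ((cmod (P x))\<^sup>2 / flux_coeff x) - of_real (wgt x * (cmod (u x))\<^sup>2) * lam"
    by (simp add: complex_norm_square mult_ac del: of_real_power)
  moreover have "Im (of_real ((cmod (P x))\<^sup>2 / flux_coeff x) - of_real (wgt x * (cmod (u x))\<^sup>2) * lam) =
      - Im lam * (wgt x * (cmod (u x))\<^sup>2)"
    by (simp add: mult_ac del: of_real_power of_real_mult)
  ultimately show ?thesis
    unfolding has_real_derivative_iff_has_vector_derivative by metis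
qed

lemma wronskian_const:
  assumes "solution_pair lam u P" "solution_pair lam v Q" "x > 0" "y > 0"
  shows "u x * Q x - v x * P x = u y * Q y - v y * P y"
proof -
  have "\<exists>c. \<forall>x\<in>{0<..}. u x * Q x - v x * P x = c"
  proof (rule has_vector_derivative_zero_constant)
    fix x :: real assume x: "x \<in> {0<..}"
    note d = solution_pairD[OF assms(1), of x] solution_pairD[OF assms(2), of x]
    have "((\<lambda>x. u x * Q x - v x * P x) has_vector_derivative 
      (u x * (- lam * of_real (wgt x) * v x) + P x / of_real (flux_coeff x) * Q x)
      - (v x * (- lam * of_real (wgt x) * u x) + Q x / of_real (flux_coeff x) * P x)) (at x within {0<..})"
      using x by (intro derivative_intros d[THEN has_vector_derivative_at_within]) auto
    thus "((\<lambda>x. u x * Q x - v x * P x) has_vector_derivative 0) (at x within {0<..})"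
      by simp
  qed (auto simp: convex_real_interval)
  thus ?thesis using assms by (metis greaterThan_iff)
qed

text \<open>If \<open>P\<close> were not \<open>O(x\<^sup>3)\<close>, then \<open>u' = P / flux_coeff\<close> would be at least of order \<open>1 / x\<^sup>2\<close> in a fixed
  direction, and \<open>u\<close> would be unbounded.\<close>

lemma flux_cube_bound:
  assumes sol: "solution_pair lam u P" and lim: "(u \<longlongrightarrow> l) (at_right 0)"
  shows "\<exists>K. \<forall>\<^sub>F x in at_right 0. cmod (P x) \<le> K * x ^ 3"
proof -
  define B where "B = cmod l + 1"
  have B: "B > 0" unfolding B_def by (simp add: add_nonneg_pos)
  have "\<forall>\<^sub>F x in at_right 0. cmod (u x) < B"
    using tendsto_norm[OF lim] by (rule order_tendstoD) (simp add: B_def)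
  then obtain d where d: "d > 0" "\<And>x. 0 < x \<Longrightarrow> x < d \<Longrightarrow> cmod (u x) < B"
    unfolding eventually_at_right_field by auto
  define K where "K = cmod lam * B"
  have K: "K \<ge> 0" using B by (simp add: K_def)
  \<comment> \<open>Integrates \<open>P' = - lam * wgt * u\<close>, where \<open>wgt\<close> is at
    most the square of \<open>x\<close> and \<open>cmod (u s) < B\<close>.\<close>
  have lip: "cmod (P x - P t) \<le> K * x ^ 3" if "0 < t" "t < x" "x < d" for t x
  proof -
    have "norm (P x - P t) \<le> K * x\<^sup>2 * x - K * x\<^sup>2 * t"
    proof (rule differentiable_bound_general[OF that(2)])
      show "continuous_on {t..x} P"
        using solution_pair_isCont[OF sol] that by (intro continuous_at_imp_continuous_on) auto
      show "continuous_on {t..x} ((*) (K * x\<^sup>2))" by (intro continuous_intros)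
      fix s assume s: "t < s" "s < x"
      show "(P has_vector_derivative - lam * of_real (wgt s) * u s) (at s)"
        using solution_pairD[OF sol, of s] that s by simp
      show "((*) (K * x\<^sup>2) has_vector_derivative K * x\<^sup>2) (at s)"
        by (auto intro!: derivative_eq_intros simp flip: has_real_derivative_iff_has_vector_derivative)
      have "wgt s \<le> x\<^sup>2" using wgt_le[of s] power_mono[of s x 2] s that by linarith
      hence "cmod lam * wgt s * cmod (u s) \<le> cmod lam * x\<^sup>2 * B"
        using d(2)[of s] s that wgt_nonneg[of s] by (intro mult_mono) auto
      thus "cmod (- lam * of_real (wgt s) * u s) \<le> K * x\<^sup>2"
        using wgt_nonneg[of s] by (simp add: norm_mult K_def mult_ac)
    qed
    also have "\<dots> \<le> K * x ^ 3" using that K by (simp add: power2_eq_square power3_eq_cube)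
    finally show ?thesis .
  qed
  have "cmod (P x) \<le> K * x ^ 3" if x: "0 < x" "x < d" for x
  proof (rule ccontr)
    assume "\<not> cmod (P x) \<le> K * x ^ 3"
    hence neg: "cmod (P x) > K * x ^ 3" by simp
    hence P0: "cmod (P x) > 0" using K x by (smt (verit) mult_nonneg_nonneg zero_le_power)
    \<comment> \<open>By \<open>lip\<close>, the component \<open>Re (cnj (P x) * P s)\<close> is at
      least \<open>k\<close> for every \<open>s\<close> in \<open>(0, x]\<close>.\<close>
    define k where "k = cmod (P x) * (cmod (P x) - K * x ^ 3)"
    have k: "k > 0" using neg P0 by (simp add: k_def)
    define C where "C = 2 / sqrt pi"
    have C: "C > 0" by (simp add: C_def)
    define h where "h = (\<lambda>t. Re (cnj (P x) * u t))"
    \<comment> \<open>The derivative of \<open>h\<close> is at least \<open>k / (C * s^2)\<close>,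
      which is minus the derivative of \<open>k / C / s\<close>. As \<open>t\<close> tends to 0 this
      would drive \<open>h t\<close> to minus infinity, although \<open>u\<close> converges.\<close>
    have mono: "h t + k / C / t \<le> h x + k / C / x" if t: "0 < t" "t < x" for t
    proof (rule DERIV_nonneg_imp_nondecreasing[of t x "\<lambda>t. h t + k / C / t"])
      show "t \<le> x" using t by simp
    next
      fix s assume s: "t \<le> s" "s \<le> x"
      hence s0: "s > 0" using t by simp
      have "((\<lambda>t. cnj (P x) * u t) has_vector_derivative cnj (P x) * (P s / of_real (flux_coeff s))) (at s)"
        by (intro derivative_intros solution_pairD[OF sol s0])
      hence "(h has_vector_derivative Re (cnj (P x) * (P s / of_real (flux_coeff s)))) (at s)"
        unfolding h_def by (rule bounded_linear.has_vector_derivative[OF bounded_linear_Re])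
      hence h: "(h has_real_derivative Re (cnj (P x) * P s) / flux_coeff s) (at s)"
        by (simp add: has_real_derivative_iff_has_vector_derivative)
      have "((\<lambda>t. k / C / t) has_real_derivative - (k / C / s\<^sup>2)) (at s)"
        using s0 C by (auto intro!: derivative_eq_intros simp: field_simps power2_eq_square)
      from DERIV_add[OF h this]
      have D: "((\<lambda>t. h t + k / C / t) has_real_derivative Re (cnj (P x) * P s) / flux_coeff s - k / C / s\<^sup>2) (at s)"
        by simp
      have "cmod (P s - P x) \<le> K * x ^ 3" 
        using lip[of s x] s s0 x K by (cases "s = x") (auto simp: norm_minus_commute)
      hence "cmod (P x) * cmod (P s - P x) \<le> cmod (P x) * (K * x ^ 3)"
        by (intro mult_left_mono) auto
      hence "\<bar>Re (cnj (P x) * (P s - P x))\<bar> \<le> cmod (P x) * (K * x ^ 3)"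
        using abs_Re_le_cmod[of "cnj (P x) * (P s - P x)"] by (simp add: norm_mult)
      moreover have "Re (cnj (P x) * P s) = (cmod (P x))\<^sup>2 + Re (cnj (P x) * (P s - P x))"
        unfolding cmod_power2 by (simp add: algebra_simps power2_eq_square)
      ultimately have "Re (cnj (P x) * P s) \<ge> k" by (simp add: k_def power2_eq_square algebra_simps)
      hence "k / (C * s\<^sup>2) \<le> Re (cnj (P x) * P s) / flux_coeff s"
        using flux_coeff_le[OF s0] flux_coeff_pos[OF s0] k unfolding C_def by (intro frac_le) auto
      hence "Re (cnj (P x) * P s) / flux_coeff s - k / C / s\<^sup>2 \<ge> 0" by simp
      with D show "\<exists>y. ((\<lambda>t. h t + k / C / t) has_real_derivative y) (at s) \<and> 0 \<le> y" by blast
    qed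
    have "(h \<longlongrightarrow> Re (cnj (P x) * l)) (at_right 0)" 
      unfolding h_def by (intro tendsto_intros lim)
    hence "\<forall>\<^sub>F t in at_right 0. h t > Re (cnj (P x) * l) - 1" 
      by (rule order_tendstoD) simp
    moreover have "filterlim (\<lambda>t. k / C / t) at_top (at_right 0)"
      using k C by real_asymp
    hence "\<forall>\<^sub>F t in at_right 0. k / C / t > h x + k / C / x - (Re (cnj (P x) * l) - 1)"
      by (auto simp: filterlim_at_top_dense)
    moreover have "\<forall>\<^sub>F t in at_right 0. 0 < t \<and> t < x"
      using x(1) by (auto simp: eventually_at_right_field)
    ultimately have "\<forall>\<^sub>F t in at_right (0::real). False"
      by eventually_elim (use mono in force)
    thus False by simp
  qed
  thus ?thesis using d(1) unfolding eventually_at_right_field by blast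
qed

text \<open>Both limits follow from the cubic bound. The first one is made to be paired with a
  solution of order \<open>1 / x\<close>: it makes the product of such a solution with
  \<open>P\<close> vanish at the origin.\<close>

lemma bounded_sol_flux:
  assumes "solution_pair lam u P" "(u \<longlongrightarrow> l) (at_right 0)"
  shows "((\<lambda>x. P x / of_real x) \<longlongrightarrow> 0) (at_right 0)" "(P \<longlongrightarrow> 0) (at_right 0)"
proof -
  obtain K where K: "\<forall>\<^sub>F x in at_right 0. cmod (P x) \<le> K * x ^ 3"
    using flux_cube_bound[OF assms] by blast
  show "((\<lambda>x. P x / of_real x) \<longlongrightarrow> 0) (at_right 0)"
  proof (rule Lim_null_comparison)
    show "\<forall>\<^sub>F x in at_right 0. norm (P x / of_real x) \<le> K * x\<^sup>2"
      using K eventually_at_right_less[of 0]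
      by eventually_elim (auto simp: norm_divide field_simps power2_eq_square power3_eq_cube)
    show "((\<lambda>x::real. K * x\<^sup>2) \<longlongrightarrow> 0) (at_right 0)" by real_asymp
  qed
  show "(P \<longlongrightarrow> 0) (at_right 0)"
  proof (rule Lim_null_comparison)
    show "((\<lambda>x::real. K * x ^ 3) \<longlongrightarrow> 0) (at_right 0)" by real_asymp
  qed (use K in simp)
qed

text \<open>Differentiating \<open>F (- s) = F s\<close> at 0 gives \<open>- D = D\<close>.\<close>

lemma even_imp_deriv_0:
  assumes "F analytic_on {0}" "even_near_0 F"
  shows "(F has_field_derivative 0) (at 0)"
proof -
  from assms(1) obtain D where D: "(F has_field_derivative D) (at 0)"
    by (auto simp: field_differentiable_def dest!: analytic_on_imp_differentiable_at)
  have "((\<lambda>s. F (- s)) has_field_derivative - D) (at 0)"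
    using DERIV_chain2[of F D "uminus" 0 "-1" UNIV] D 
      DERIV_minus[OF DERIV_ident, of 0 UNIV] by auto
  moreover have "((\<lambda>s. F (- s)) has_field_derivative - D) (at 0) \<longleftrightarrow> (F has_field_derivative - D) (at 0)"
    using assms(2) unfolding even_near_0_def by (intro DERIV_cong_ev) auto
  ultimately have "- D = D" using D DERIV_unique by blast
  thus ?thesis using D by simp
qed

text \<open>Here \<open>u\<close> is of order \<open>1 / x\<close> and \<open>P\<close> tends to -1,
  so \<open>P * cnj u\<close> is unbounded and only its imaginary part can converge. That part
  equals \<open>Im (z * cnj y) / x\<close>; evenness makes the numerator have derivative 0 at the
  origin, and the numerator vanishes there because \<open>Y 0\<close> and \<open>Z 0\<close> are
  real.\<close>

lemma u0_at_0:
  assumes "is_u0 lam u"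
  defines "P \<equiv> \<lambda>x. of_real (flux_coeff x) * vector_derivative u (at x)"
  shows "((\<lambda>x. of_real x * u x) \<longlongrightarrow> of_real (3 * sqrt pi / 2)) (at_right 0)"
    and "(P \<longlongrightarrow> -1) (at_right 0)"
    and "((\<lambda>x. Im (P x * cnj (u x))) \<longlongrightarrow> 0) (at_right 0)"
proof -
  obtain Y Z where YZ: "Y analytic_on {0}" "Z analytic_on {0}" "even_near_0 Y" "even_near_0 Z"
    "\<forall>\<^sub>F x in at_right 0. Y (of_real x) = y_of u x" "\<forall>\<^sub>F x in at_right 0. Z (of_real x) = z_of u x"
    "Y 0 = of_real (3 * sqrt pi / 2)" "Z 0 = -1"
    using assms(1) unfolding is_u0_def analytic_extension_at_0_def by auto
  have dY: "((\<lambda>x. Y (of_real x)) has_vector_derivative 0) (at 0)"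
    and dZ: "((\<lambda>x. Z (of_real x)) has_vector_derivative 0) (at 0)"
    using has_vector_derivative_real_field[of Y 0 0 UNIV] has_vector_derivative_real_field[of Z 0 0 UNIV]
      even_imp_deriv_0[OF YZ(1,3)] even_imp_deriv_0[OF YZ(2,4)] by (auto simp: o_def)
  have "isCont (\<lambda>x. Y (of_real x)) 0" "isCont (\<lambda>x. Z (of_real x)) 0"
    using dY dZ has_vector_derivative_continuous by blast+
  hence "((\<lambda>x. Y (of_real x)) \<longlongrightarrow> Y 0) (at_right 0)" "((\<lambda>x. Z (of_real x)) \<longlongrightarrow> Z 0) (at_right 0)"
    by (auto simp: isCont_def intro: filterlim_mono[OF _ order_refl at_le])
  hence y: "(y_of u \<longlongrightarrow> of_real (3 * sqrt pi / 2)) (at_right 0)" and z: "(z_of u \<longlongrightarrow> -1) (at_right 0)"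
    using tendsto_cong[OF YZ(5)] tendsto_cong[OF YZ(6)] YZ(7,8) by auto
  have e: "((\<lambda>x::real. exp (x\<^sup>2 / 2)) \<longlongrightarrow> 1) (at_right 0)" 
     "((\<lambda>x::real. exp (- (x\<^sup>2) / 2)) \<longlongrightarrow> 1) (at_right 0)" by real_asymp+
  have "((\<lambda>x. of_real (exp (x\<^sup>2 / 2)) * y_of u x) \<longlongrightarrow> of_real 1 * of_real (3 * sqrt pi / 2)) (at_right 0)"
    by (intro tendsto_intros e y)
  moreover have "of_real (exp (x\<^sup>2 / 2)) * y_of u x = of_real x * u x" for x
    by (simp add: y_of_def exp_minus field_simps)
  ultimately show "((\<lambda>x. of_real x * u x) \<longlongrightarrow> of_real (3 * sqrt pi / 2)) (at_right 0)"
    by simp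
  have "((\<lambda>x. of_real (exp (- (x\<^sup>2) / 2)) * z_of u x) \<longlongrightarrow> of_real 1 * (-1)) (at_right 0)"
    by (intro tendsto_intros e z)
  moreover have ee: "exp (- (x\<^sup>2) / 2) * exp (- (x\<^sup>2) / 2) = exp (- (x\<^sup>2))" for x :: real
    by (simp flip: exp_add)
  hence "of_real (exp (- (x\<^sup>2) / 2)) * z_of u x = P x" for x
    by (simp add: z_of_def P_def flux_coeff_def wgt_def mult_ac flip: ee)
  ultimately show "(P \<longlongrightarrow> -1) (at_right 0)" by simp
  \<comment> \<open>Since \<open>h 0 = 0\<close>, the quotient \<open>h x / x\<close> is the
    difference quotient of \<open>h\<close> at 0 and converges to the derivative 0.\<close>
  define h where "h = (\<lambda>x. Im (Z (of_real x) * cnj (Y (of_real x))))"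
  have "((\<lambda>x. Z (of_real x) * cnj (Y (of_real x))) has_vector_derivative 
      Z (of_real 0) * cnj 0 + 0 * cnj (Y (of_real 0))) (at 0)"
    by (intro derivative_intros has_vector_derivative_cnj dY dZ)
  from bounded_linear.has_vector_derivative[OF bounded_linear_Im this]
  have "(h has_real_derivative 0) (at 0)" 
    by (simp add: h_def has_real_derivative_iff_has_vector_derivative)
  hence "((\<lambda>x. h x / x) \<longlongrightarrow> 0) (at 0)"
    using YZ(7,8) by (simp add: DERIV_def h_def)
  hence "((\<lambda>x. h x / x) \<longlongrightarrow> 0) (at_right 0)"
    by (rule filterlim_mono[OF _ order_refl at_le]) simp
  moreover have "\<forall>\<^sub>F x in at_right 0. h x / x = Im (P x * cnj (u x))"
    using YZ(5,6) eventually_at_right_less[of 0]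
  proof eventually_elim
    case (elim x)
    have "P x * cnj (u x) * of_real x = z_of u x * cnj (y_of u x)"
      by (simp add: z_of_def y_of_def P_def flux_coeff_def wgt_def mult_ac flip: ee)
    hence "Im (P x * cnj (u x) * of_real x) = h x" using elim by (simp add: h_def)
    thus ?case using elim by (simp add: field_simps)
  qed
  ultimately show "((\<lambda>x. Im (P x * cnj (u x))) \<longlongrightarrow> 0) (at_right 0)" 
    by (simp add: tendsto_cong)
qed

section \<open>Growth of solutions with negative flux\<close>

text \<open>A Gronwall argument: once \<open>b x < a / 2\<close>, the function
  \<open>exp x * (f x - a / 2)\<close> is nonincreasing, so \<open>f\<close> exceeds
  \<open>a / 2\<close> by at most a decaying exponential.\<close>

lemma tendsto_0_of_deriv_le:
  fixes f f' b :: "real \<Rightarrow> real"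
  assumes deriv: "\<forall>\<^sub>F x in at_top. (f has_real_derivative f' x) (at x)"
    and le: "\<forall>\<^sub>F x in at_top. f' x \<le> - f x + b x"
    and nonneg: "\<forall>\<^sub>F x in at_top. 0 \<le> f x"
    and b: "(b \<longlongrightarrow> 0) at_top"
  shows "(f \<longlongrightarrow> 0) at_top"
proof (rule order_tendstoI)
  fix a :: real assume a: "a < 0"
  show "\<forall>\<^sub>F x in at_top. a < f x" using nonneg by eventually_elim (use a in simp)
next
  fix a :: real assume a: "0 < a"
  have "\<forall>\<^sub>F x in at_top. b x < a / 2" using b by (rule order_tendstoD) (use a in simp)
  hence "\<forall>\<^sub>F x in at_top. (f has_real_derivative f' x) (at x) \<and> f' x \<le> - f x + a / 2"
    using deriv le by eventually_elim auto
  then obtain X where X: "\<And>x. x \<ge> X \<Longrightarrow> (f has_real_derivative f' x) (at x) \<and> f' x \<le> - f x + a / 2"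
    unfolding eventually_at_top_linorder by auto
  define C where "C = exp X * (f X - a / 2)"
  have bd: "f x \<le> a / 2 + C * exp (- x)" if "x \<ge> X" for x
  proof -
    have "exp x * (f x - a / 2) \<le> C" unfolding C_def
    proof (rule DERIV_nonpos_imp_nonincreasing[OF that, of "\<lambda>x. exp x * (f x - a / 2)"])
      fix t assume t: "X \<le> t" "t \<le> x"
      have "((\<lambda>x. exp x * (f x - a / 2)) has_real_derivative (exp t * (f t - a / 2) + f' t * exp t)) (at t)"
        using X[OF t(1)] by (auto intro!: derivative_eq_intros)
      moreover have "exp t * (f t - a / 2) + f' t * exp t = exp t * (f t - a / 2 + f' t)"
        by (simp add: algebra_simps)
      moreover have "\<dots> \<le> 0" using X[OF t(1)] by (intro mult_nonneg_nonpos) auto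
      ultimately show "\<exists>y. ((\<lambda>x. exp x * (f x - a / 2)) has_real_derivative y) (at t) \<and> y \<le> 0"
        by metis
    qed
    thus ?thesis by (simp add: exp_minus field_simps)
  qed
  have "((\<lambda>x. a / 2 + C * exp (- x)) \<longlongrightarrow> a / 2 + C * 0) at_top"
    by (intro tendsto_intros) real_asymp
  hence "\<forall>\<^sub>F x in at_top. a / 2 + C * exp (- x) < a" 
    by (rule order_tendstoD) (use a in simp)
  thus "\<forall>\<^sub>F x in at_top. f x < a" 
    using eventually_ge_at_top[of X] by eventually_elim (use bd in force)
qed

section \<open>Approximate WKB diagonalisation of the system\<close>

lemma cmod_square_deriv:
  assumes "(f has_vector_derivative f') (at x)"
  shows "((\<lambda>x. (cmod (f x))\<^sup>2) has_real_derivative 2 * Re (cnj (f x) * f')) (at x)"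
proof -
  have "((\<lambda>x. f x \<bullet> f x) has_vector_derivative (f x \<bullet> f' + f' \<bullet> f x)) (at x)"
    by (rule bounded_bilinear.has_vector_derivative[OF bounded_bilinear_inner assms assms])
  moreover have "f x \<bullet> f' + f' \<bullet> f x = 2 * Re (cnj (f x) * f')"
    by (simp add: inner_complex_def mult_ac)
  ultimately show ?thesis
    by (simp add: has_real_derivative_iff_has_vector_derivative power2_norm_eq_inner)
qed

text \<open>Negative flux is all that the analysis at infinity has to know about the behaviour of
  the solution at the origin. The locale is later interpreted with \<open>u1\<close>.\<close>

locale growing_solution =
  fixes lam :: complex and u P :: "real \<Rightarrow> complex"
  assumes sol: "solution_pair lam u P"
    and Im_lam: "Im lam > 0"
    and flux_neg: "\<And>x. x > 0 \<Longrightarrow> Im (P x * cnj (u x)) < 0"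
begin

definition kap :: complex where "kap = csqrt (2 * lam)"

lemma kap_sq: "kap\<^sup>2 = 2 * lam" by (simp add: kap_def)

text \<open>Comparing imaginary parts in \<open>kap\<^sup>2 = 2 * lam\<close> gives
  \<open>Re kap * Im kap = Im lam > 0\<close>, and the principal branch has nonnegative real
  part.\<close>

lemma Re_kap: "Re kap > 0" and Im_kap: "Im kap > 0"
proof -
  have 1: "Re kap * Im kap = Im lam" 
    using arg_cong[OF kap_sq, of Im] by (simp add: power2_eq_square mult_ac)
  have 2: "Re kap \<ge> 0" using csqrt_principal[of "2 * lam"] by (auto simp: kap_def)
  show "Re kap > 0" using 1 2 Im_lam by (cases "Re kap = 0") auto
  thus "Im kap > 0" using 1 Im_lam by (metis zero_less_mult_pos)
qed

lemma kap_nz: "kap \<noteq> 0" using Re_kap by auto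

text \<open>The first two terms of the expansion of the square root of
  \<open>2 * lam * x - 1\<close> for large \<open>x\<close>. Its square differs from
  \<open>2 * lam * x - 1\<close> by \<open>1 / (4 * kap^2 * x)\<close>, and no branch of a variable
  square root has to be followed.\<close>

definition phase_quot :: "real \<Rightarrow> complex" where
  "phase_quot x = kap * of_real (sqrt x) - inverse (2 * kap * of_real (sqrt x))"

text \<open>For positive \<open>x\<close> the functions \<open>v\<close> and \<open>q\<close> are
  \<open>y / x\<close> and \<open>z\<close> for the pair belonging to \<open>u\<close>: the Gaussian
  weights leave the system, while \<open>q * cnj v\<close> is still
  \<open>P * cnj u\<close>.\<close>

definition v :: "real \<Rightarrow> complex" where "v x = of_real (exp (- (x\<^sup>2) / 2)) * u x"
definition q :: "real \<Rightarrow> complex" where "q x = of_real (exp (x\<^sup>2 / 2)) * P x"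

text \<open>Chosen so that \<open>x + eig_row s x * (2 * x / erf_defect x)\<close>, the coefficient
  of \<open>q\<close> after differentiation, is exactly the eigenvalue.\<close>

definition eig_row :: "real \<Rightarrow> real \<Rightarrow> complex" where
  "eig_row s x = - (\<i> * of_real s * phase_quot x + 1) * of_real (erf_defect x / 2)"

text \<open>The component along an approximate eigenvector; since \<open>Im kap > 0\<close>, it is
  the growing one for \<open>s = 1\<close> and the decaying one for \<open>s = -1\<close>.\<close>

definition amplitude :: "real \<Rightarrow> real \<Rightarrow> complex" where
  "amplitude s x = q x + eig_row s x * v x"

definition phase_quot_diff :: "real \<Rightarrow> complex" where
  "phase_quot_diff x = kap / (2 * of_real (sqrt x)) + inverse (4 * kap * of_real (x * sqrt x))"

definition eig_row_diff :: "real \<Rightarrow> real \<Rightarrow> complex" where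
  "eig_row_diff s x = - (\<i> * of_real s * phase_quot x + 1) * of_real (2 / sqrt pi * wgt x) 
     - \<i> * of_real s * phase_quot_diff x * of_real (erf_defect x / 2)"

text \<open>The three terms come from the variation of the row, from replacing
  \<open>erf_defect\<close> by its limit 1 in the term with \<open>lam\<close>, and from truncating
  \<open>phase_quot\<close>.\<close>

definition remainder :: "real \<Rightarrow> real \<Rightarrow> complex" where
  "remainder s x = eig_row_diff s x + lam * of_real (x\<^sup>2 * (erf_defect x - 1)) + of_real (erf_defect x) / (8 * kap\<^sup>2)"

lemma phase_quot_deriv: assumes "x > 0" shows "(phase_quot has_vector_derivative phase_quot_diff x) (at x)"
proof -
  have s: "((\<lambda>x. of_real (sqrt x) :: complex) has_vector_derivative of_real (inverse (sqrt x) / 2)) (at x)"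
    using assms by (intro has_vector_derivative_of_real) (auto intro!: derivative_eq_intros)
  have i: "((\<lambda>x. of_real (inverse (sqrt x)) :: complex) has_vector_derivative 
       of_real (- (inverse (sqrt x) / 2) / x)) (at x)"
    using assms by (intro has_vector_derivative_of_real) 
     (auto intro!: derivative_eq_intros simp: power2_eq_square field_simps)
  have "phase_quot = (\<lambda>x. kap * of_real (sqrt x) - inverse (2 * kap) * of_real (inverse (sqrt x)))"
    by (auto simp: phase_quot_def fun_eq_iff)
  moreover have "((\<lambda>x. kap * of_real (sqrt x) - inverse (2 * kap) * of_real (inverse (sqrt x)))
     has_vector_derivative kap * of_real (inverse (sqrt x) / 2) - 
      inverse (2 * kap) * of_real (- (inverse (sqrt x) / 2) / x)) (at x)"
    by (intro derivative_intros s i)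
  moreover have "kap * of_real (inverse (sqrt x) / 2) - 
      inverse (2 * kap) * of_real (- (inverse (sqrt x) / 2) / x) = phase_quot_diff x"
    using kap_nz assms by (simp add: phase_quot_diff_def field_simps)
  ultimately show ?thesis by simp
qed

lemma erf_defect_deriv_complex: 
  "((\<lambda>x. of_real (erf_defect x / 2) :: complex) has_vector_derivative of_real (2 / sqrt pi * wgt x)) (at x)"
  using DERIV_cdivide[OF erf_defect_DERIV, of 2 x] by (intro has_vector_derivative_of_real) simp

lemma eig_row_deriv: assumes "x > 0" shows "(eig_row s has_vector_derivative eig_row_diff s x) (at x)"
proof -
  have "((\<lambda>x. - (\<i> * of_real s * phase_quot x + 1) * of_real (erf_defect x / 2)) has_vector_derivative
    - (\<i> * of_real s * phase_quot x + 1) * of_real (2 / sqrt pi * wgt x) 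
    + (- (\<i> * of_real s * phase_quot_diff x + 0)) * of_real (erf_defect x / 2)) (at x)"
    by (intro derivative_intros phase_quot_deriv assms erf_defect_deriv_complex)
  thus ?thesis by (simp add: eig_row_def[abs_def] eig_row_diff_def)
qed

lemma v_deriv: assumes x: "x > 0" 
  shows "(v has_vector_derivative - of_real x * v x + of_real (2 * x / erf_defect x) * q x) (at x)"
proof -
  have e: "((\<lambda>x. of_real (exp (- (x\<^sup>2) / 2)) :: complex) has_vector_derivative 
     of_real (- x * exp (- (x\<^sup>2) / 2))) (at x)"
    by (intro has_vector_derivative_of_real) (auto intro!: derivative_eq_intros)
  have "(v has_vector_derivative of_real (exp (- (x\<^sup>2) / 2)) * (P x / of_real (flux_coeff x)) +
     of_real (- x * exp (- (x\<^sup>2) / 2)) * u x) (at x)"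
    unfolding v_def by (intro derivative_intros e solution_pairD[OF sol x])
  moreover have "exp (- (x\<^sup>2) / 2) / flux_coeff x = 2 * x / erf_defect x * exp (x\<^sup>2 / 2)"
  proof -
    have "exp (- (x\<^sup>2) / 2) = exp (- (x\<^sup>2)) * exp (x\<^sup>2 / 2)" by (simp flip: exp_add)
    thus ?thesis using x erf_defect_pos[OF x] by (simp add: flux_coeff_erf_defect field_simps)
  qed
  hence "of_real (exp (- (x\<^sup>2) / 2) / flux_coeff x) * P x = of_real (2 * x / erf_defect x * exp (x\<^sup>2 / 2)) * P x"
    by (simp only:)
  hence "of_real (exp (- (x\<^sup>2) / 2)) * (P x / of_real (flux_coeff x)) = of_real (2 * x / erf_defect x) * q x"
    unfolding q_def of_real_mult of_real_divide by (simp add: mult_ac)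
  ultimately show ?thesis by (simp add: v_def mult.assoc)
qed

lemma q_deriv: assumes x: "x > 0" 
  shows "(q has_vector_derivative of_real x * q x - lam * of_real (x\<^sup>2) * v x) (at x)"
proof -
  have e: "((\<lambda>x. of_real (exp (x\<^sup>2 / 2)) :: complex) has_vector_derivative 
     of_real (x * exp (x\<^sup>2 / 2))) (at x)"
    by (intro has_vector_derivative_of_real) (auto intro!: derivative_eq_intros)
  have D: "(q has_vector_derivative of_real (exp (x\<^sup>2 / 2)) * (- lam * of_real (wgt x) * u x) +
     of_real (x * exp (x\<^sup>2 / 2)) * P x) (at x)"
    unfolding q_def by (intro derivative_intros e solution_pairD[OF sol x])
  have "exp (x\<^sup>2 / 2) * wgt x = x\<^sup>2 * exp (- (x\<^sup>2) / 2)"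
    by (simp add: wgt_def flip: exp_add)
  hence "- lam * of_real (exp (x\<^sup>2 / 2) * wgt x) * u x = - lam * of_real (x\<^sup>2 * exp (- (x\<^sup>2) / 2)) * u x"
    by (simp only:)
  hence eq: "of_real (exp (x\<^sup>2 / 2)) * (- lam * of_real (wgt x) * u x) = - lam * of_real (x\<^sup>2) * v x"
    unfolding v_def of_real_mult by (simp only: mult_ac mult_minus_left mult_minus_right)
  show ?thesis using D unfolding eq by (simp add: q_def mult.assoc)
qed

text \<open>Up to the bounded term \<open>remainder\<close>, the rows \<open>(1, eig_row s)\<close> are left eigenvectors of the first-order
  system for \<open>(q, v)\<close>, with eigenvalues \<open>- \<i> s \<phi>\<close> where \<open>\<phi> = x * phase_quot x\<close> satisfies \<open>\<phi>\<^sup>2 = 2\<lambda>x\<^sup>3 - x\<^sup>2 + O(x)\<close>.\<close>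

lemma amplitude_deriv: assumes x: "x > 0" and s: "s\<^sup>2 = 1"
  shows "(amplitude s has_vector_derivative - \<i> * of_real (s * x) * phase_quot x * amplitude s x + remainder s x * v x) (at x)"
proof -
  have "(amplitude s has_vector_derivative (of_real x * q x - lam * of_real (x\<^sup>2) * v x) +
     (eig_row s x * (- of_real x * v x + of_real (2 * x / erf_defect x) * q x) + eig_row_diff s x * v x)) (at x)"
    unfolding amplitude_def by (intro derivative_intros q_deriv v_deriv eig_row_deriv x)
  moreover have "(of_real x * q x - lam * of_real (x\<^sup>2) * v x) +
     (eig_row s x * (- of_real x * v x + of_real (2 * x / erf_defect x) * q x) + eig_row_diff s x * v x) =
     - \<i> * of_real (s * x) * phase_quot x * amplitude s x + remainder s x * v x"
  proof -
    define X E f S where "X = (of_real x :: complex)" and "E = (of_real (erf_defect x) :: complex)" 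
      and "f = phase_quot x" and "S = (of_real s :: complex)"
    have E: "E \<noteq> 0" using erf_defect_pos[OF x] by (simp add: E_def)
    have S: "S * S = 1" using s by (simp add: S_def power2_eq_square flip: of_real_mult)
    define r where "r = (of_real (sqrt x) :: complex)"
    have r: "r * r = X" "r \<noteq> 0" using x by (auto simp: r_def X_def simp flip: of_real_mult)
    have l: "kap * kap * X * X = 2 * lam * X * X" using kap_sq by (simp add: power2_eq_square)
    define g where "g = inverse (2 * kap)"
    have g: "kap * g = 1 / 2" "g * g = 1 / (4 * (kap * kap))" 
      using kap_nz by (auto simp: g_def field_simps)
    have "r * f = kap * X - g"
      using r(2) kap_nz by (simp add: f_def phase_quot_def g_def r_def[symmetric] right_diff_distrib r(1)[symmetric])
    hence "(r * r) * (f * f) = (kap * X - g) * (kap * X - g)" by (simp add: mult_ac)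
    also have "\<dots> = kap * kap * X * X - 2 * (kap * g) * X + g * g" by (simp add: algebra_simps)
    \<comment> \<open>The truncation error: the last summand is the excess over
      \<open>x * (2 * lam * x - 1)\<close>.\<close>
    finally have f: "X * (f * f) = 2 * lam * X * X - X + 1 / (4 * (kap * kap))"
      unfolding g r l by simp
    have eig_row: "eig_row s x = - (\<i> * S * f + 1) * E / 2"
      by (simp add: eig_row_def f_def S_def E_def)
    have 1: "X + eig_row s x * (2 * X / E) = - \<i> * S * X * f"
      unfolding eig_row using E by (simp add: field_simps)
    have "(\<i> * S * X * f) * eig_row s x - eig_row s x * X = X * E / 2 * (1 - (\<i> * S * f) * (\<i> * S * f))"
      unfolding eig_row by (simp add: field_simps)
    also have "(\<i> * S * f) * (\<i> * S * f) = - ((S * S) * (f * f))" by (simp add: mult_ac)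
    also have "X * E / 2 * (1 - - ((S * S) * (f * f))) = E / 2 * (X + X * (f * f))"
      unfolding S by (simp add: algebra_simps)
    also have "\<dots> = lam * X * X * E + E / (8 * (kap * kap))"
      unfolding f by (simp add: algebra_simps)
    finally have "eig_row s x * X = (\<i> * S * X * f) * eig_row s x - (lam * X * X * E + E / (8 * (kap * kap)))"
      by (simp add: algebra_simps)
    \<comment> \<open>The coefficient of \<open>v\<close> is the eigenvalue times the row up to
      \<open>remainder\<close>; together with \<open>1\<close> this is the approximate left
      eigenvector equation.\<close>
    hence 2: "eig_row_diff s x - lam * X * X - eig_row s x * X = - \<i> * S * X * f * eig_row s x + remainder s x"
      by (simp add: remainder_def X_def[symmetric] E_def[symmetric] power2_eq_square algebra_simps)
    have "(X * q x - lam * (X * X) * v x) +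
       (eig_row s x * (- X * v x + 2 * X / E * q x) + eig_row_diff s x * v x) =
       (X + eig_row s x * (2 * X / E)) * q x + (eig_row_diff s x - lam * X * X - eig_row s x * X) * v x"
      by (simp add: algebra_simps)
    also have "\<dots> = - \<i> * S * X * f * amplitude s x + remainder s x * v x"
      unfolding 1 2 amplitude_def by (simp add: algebra_simps)
    finally show ?thesis by (simp add: X_def E_def f_def S_def power2_eq_square mult_ac)
  qed
  ultimately show ?thesis by simp
qed


end

section \<open>Half-integer powers, written with \<open>sqrt\<close>\<close>

lemma mult_of_real_sel: "Re (z * of_real r) = Re z * r" "Im (z * of_real r) = Im z * r"
  by simp_all

lemma mult_inverse_sqrt: "x \<ge> 0 \<Longrightarrow> x * inverse (sqrt x) = sqrt x"
  by (metis real_div_sqrt divide_inverse)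

lemma DERIV_mult_sqrt:
  assumes "x > 0"
  shows "((\<lambda>x. x * sqrt x) has_real_derivative 3 / 2 * sqrt x) (at x)"
  by (rule DERIV_cong[OF DERIV_mult[OF DERIV_ident DERIV_real_sqrt[OF assms]]])
     (use mult_inverse_sqrt[of x] assms in \<open>simp add: mult.commute\<close>)

lemma DERIV_square_mult_sqrt:
  assumes "x > 0"
  shows "((\<lambda>x. x\<^sup>2 * sqrt x) has_real_derivative 5 / 2 * (x * sqrt x)) (at x)"
proof -
  have "((\<lambda>x. x * (x * sqrt x)) has_real_derivative 5 / 2 * (x * sqrt x)) (at x)"
    by (rule DERIV_cong[OF DERIV_mult[OF DERIV_ident DERIV_mult_sqrt[OF assms]]]) simp
  thus ?thesis by (simp add: power2_eq_square mult.assoc)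
qed

section \<open>Growth of the amplitudes and of the solution\<close>

context growing_solution
begin

definition remainder_bd :: real where
  "remainder_bd = cmod kap + cmod lam + 2 / cmod kap + 1 / (8 * (cmod kap)\<^sup>2) + 1"

lemma remainder_bd_pos: "remainder_bd > 0"
  unfolding remainder_bd_def by (intro add_nonneg_pos) auto

lemma norm_phase_quot_le: assumes "x \<ge> 1" shows "cmod (phase_quot x) \<le> (cmod kap + 1 / (2 * cmod kap)) * sqrt x"
proof -
  have s: "sqrt x \<ge> 1" using assms by simp
  have "cmod (phase_quot x) \<le> cmod kap * sqrt x + inverse (2 * cmod kap * sqrt x)"
    unfolding phase_quot_def using assms by (intro norm_triangle_le_diff) (simp add: norm_mult norm_inverse)
  also have "inverse (2 * cmod kap * sqrt x) = inverse (sqrt x) * (1 / (2 * cmod kap))"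
    using kap_nz assms by (simp add: field_simps)
  also have "\<dots> \<le> sqrt x * (1 / (2 * cmod kap))"
    using s by (intro mult_right_mono order.trans[OF inverse_le_1_iff[THEN iffD2]]) auto
  finally show ?thesis by (simp add: algebra_simps)
qed

text \<open>The factor \<open>wgt\<close> beats the growth of \<open>phase_quot\<close>, the
  derivative of \<open>phase_quot\<close> stays bounded, and \<open>erf_defect_ge\<close> keeps
  \<open>x\<^sup>2 * (1 - erf_defect x)\<close> below 1.\<close>

lemma remainder_bound: assumes "\<bar>s\<bar> = 1" shows "\<forall>\<^sub>F x in at_top. cmod (remainder s x) \<le> remainder_bd"
proof -
  define c where "c = cmod kap + 1 / (2 * cmod kap)"
  have cpos: "c > 0" using kap_nz by (simp add: c_def add_pos_pos)
  have 1: "\<forall>\<^sub>F x in at_top. (c * sqrt x + 1) * (2 / sqrt pi * wgt x) \<le> 1"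
    unfolding wgt_def using cpos by real_asymp
  show ?thesis
    using 1 eventually_ge_at_top[of 1] erf_defect_ge
  proof eventually_elim
    case (elim x)
    have E: "0 \<le> erf_defect x" "erf_defect x \<le> 1" using erf_defect_pos[of x] erf_defect_le_1[of x] elim by auto
    have s: "sqrt x \<ge> 1" using elim by simp
    have "cmod (\<i> * of_real s * phase_quot x + 1) \<le> c * sqrt x + 1"
      using norm_triangle_ineq[of "\<i> * of_real s * phase_quot x" 1] norm_phase_quot_le[of x] elim assms
      by (simp add: c_def norm_mult)
    moreover from this have "0 \<le> c * sqrt x + 1" by (rule order.trans[OF norm_ge_zero])
    ultimately have "cmod ((\<i> * of_real s * phase_quot x + 1) * of_real (2 / sqrt pi * wgt x)) 
         \<le> (c * sqrt x + 1) * (2 / sqrt pi * wgt x)"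
      unfolding norm_mult using wgt_nonneg[of x] by (intro mult_mono) (auto simp: norm_mult norm_divide)
    hence b1: "cmod ((\<i> * of_real s * phase_quot x + 1) * of_real (2 / sqrt pi * wgt x)) \<le> 1"
      using elim by linarith
    have s2: "2 * sqrt x \<ge> 1" using s by linarith
    have xs: "x * sqrt x \<ge> 1" using s elim mult_mono[of 1 x 1 "sqrt x"] by auto
    have "cmod (phase_quot_diff x) \<le> cmod (kap / (2 * of_real (sqrt x))) + cmod (inverse (4 * kap * of_real (x * sqrt x)))"
      unfolding phase_quot_diff_def by (rule norm_triangle_ineq)
    also have "cmod (kap / (2 * of_real (sqrt x))) \<le> cmod kap / 1"
      unfolding norm_divide using s elim s2 by (intro divide_left_mono) (auto simp: norm_mult)
    also have "cmod (inverse (4 * kap * of_real (x * sqrt x))) = (1 / (4 * cmod kap)) * inverse (x * sqrt x)"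
    proof -
      have n: "cmod (4 * kap * of_real (x * sqrt x)) = 4 * cmod kap * (x * sqrt x)"
        unfolding norm_mult norm_of_real using elim by simp
      show ?thesis unfolding norm_inverse n by (simp only: inverse_mult_distrib divide_inverse mult_1)
    qed
    also have "\<dots> \<le> (1 / (4 * cmod kap)) * 1" 
      using inverse_le_1_iff[THEN iffD2, OF disjI2, OF xs] by (intro mult_left_mono) simp_all
    also have "(1 / (4 * cmod kap)) * 1 \<le> 2 / cmod kap" 
      using kap_nz unfolding mult_1_right by (intro frac_le) auto
    finally have "cmod (phase_quot_diff x) \<le> cmod kap + 2 / cmod kap" by simp
    hence "cmod (phase_quot_diff x) * (erf_defect x / 2) \<le> (cmod kap + 2 / cmod kap) * 1"
      using E by (intro mult_mono) auto
    hence b2: "cmod (\<i> * of_real s * phase_quot_diff x * of_real (erf_defect x / 2)) \<le> cmod kap + 2 / cmod kap"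
      using E assms by (simp add: norm_mult)
    have "\<bar>x\<^sup>2 * (erf_defect x - 1)\<bar> = x\<^sup>2 * (1 - erf_defect x)" using E by (simp add: abs_mult)
    also have "\<dots> \<le> x\<^sup>2 * (1 / x\<^sup>2)" using elim by (intro mult_left_mono) auto
    finally have "\<bar>x\<^sup>2 * (erf_defect x - 1)\<bar> \<le> 1" using elim by simp
    hence b3: "cmod (lam * of_real (x\<^sup>2 * (erf_defect x - 1))) \<le> cmod lam"
      unfolding norm_mult norm_of_real by (intro mult_left_le) auto
    have b4: "cmod (of_real (erf_defect x) / (8 * kap\<^sup>2)) \<le> 1 / (8 * (cmod kap)\<^sup>2)"
      using E by (simp add: norm_divide norm_mult norm_power divide_right_mono)
    have "cmod (remainder s x) \<le> 1 + (cmod kap + 2 / cmod kap) + cmod lam + 1 / (8 * (cmod kap)\<^sup>2)"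
      unfolding remainder_def eig_row_diff_def
      by (intro norm_triangle_mono norm_triangle_le_diff[OF add_mono] b1 b2 b3 b4, unfold mult_minus_left norm_minus_cancel)
         (intro b1 b2)+
    thus ?case by (simp add: remainder_bd_def)
  qed
qed

text \<open>As \<open>inverse kap\<close> is a positive multiple of \<open>cnj kap\<close>, the
  correction lowers the real part but raises the imaginary part. The latter is the source of the
  extra growth of order \<open>x * sqrt x\<close> in the exponent.\<close>

lemma Re_phase_quot: "Re (phase_quot x) = Re kap * (sqrt x - 1 / (2 * (cmod kap)\<^sup>2) * inverse (sqrt x))"
  and Im_phase_quot: "Im (phase_quot x) = Im kap * (sqrt x + 1 / (2 * (cmod kap)\<^sup>2) * inverse (sqrt x))"
proof -
  have "inverse kap = cnj kap / (kap * cnj kap)" using kap_nz by (simp add: field_simps)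
  also have "kap * cnj kap = of_real ((cmod kap)\<^sup>2)" by (rule complex_norm_square[symmetric])
  finally have ik: "Re (inverse kap) = Re kap / (cmod kap)\<^sup>2" "Im (inverse kap) = - Im kap / (cmod kap)\<^sup>2"
    by (simp_all only: Re_divide_of_real Im_divide_of_real complex_cnj)
       (simp_all only: complex.sel cnj.sel)
  have "phase_quot x = kap * of_real (sqrt x) - inverse kap * of_real (inverse (sqrt x) / 2)"
    by (simp add: phase_quot_def)
  hence "Re (phase_quot x) = Re kap * sqrt x - Re (inverse kap) * (inverse (sqrt x) / 2)"
    "Im (phase_quot x) = Im kap * sqrt x - Im (inverse kap) * (inverse (sqrt x) / 2)"
    by (simp_all only: minus_complex.sel mult_of_real_sel)
  thus "Re (phase_quot x) = Re kap * (sqrt x - 1 / (2 * (cmod kap)\<^sup>2) * inverse (sqrt x))"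
    "Im (phase_quot x) = Im kap * (sqrt x + 1 / (2 * (cmod kap)\<^sup>2) * inverse (sqrt x))"
    unfolding ik by (simp_all add: right_diff_distrib distrib_left)
qed

lemma qv: "q x * cnj (v x) = P x * cnj (u x)"
proof -
  have "q x * cnj (v x) = of_real (exp (x\<^sup>2 / 2) * exp (- (x\<^sup>2) / 2)) * (P x * cnj (u x))"
    by (simp only: q_def v_def complex_cnj_mult complex_cnj_complex_of_real of_real_mult mult_ac)
  thus ?thesis by (simp flip: exp_add)
qed

text \<open>The number \<open>Im (amplitude 1 x * cnj (v x))\<close> is the flux plus
  \<open>Im (eig_row 1 x) * (cmod (v x))^2\<close>. The flux is negative and the other term is at
  most \<open>- Re kap * sqrt x / 8\<close> times the square of \<open>cmod (v x)\<close>, so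
  nothing cancels. Strictness excludes zeros of the amplitude.\<close>

lemma v_le_amplitude:
  "\<forall>\<^sub>F x in at_top. amplitude 1 x \<noteq> 0 \<and> cmod (v x) \<le> 8 / (Re kap * sqrt x) * cmod (amplitude 1 x)"
proof -
  have ck: "(cmod kap)\<^sup>2 > 0" using kap_nz by simp
  have 1: "\<forall>\<^sub>F x in at_top. sqrt x - 1 / (2 * (cmod kap)\<^sup>2) * inverse (sqrt x) \<ge> sqrt x / 2"
    using ck by real_asymp
  have 2: "\<forall>\<^sub>F x in at_top. erf_defect x > 1 / 2" using erf_defect_tendsto by (rule order_tendstoD) simp
  show ?thesis using 1 2 eventually_gt_at_top[of 0]
  proof eventually_elim
    case (elim x)
    have R: "Re (phase_quot x) \<ge> Re kap * (sqrt x / 2)"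
      unfolding Re_phase_quot using elim Re_kap by (intro mult_left_mono) auto
    have R0: "0 \<le> Re (phase_quot x)" using Re_kap elim by (intro order.trans[OF _ R]) simp
    have "Re kap * (sqrt x / 2) * (1 / 4) \<le> Re (phase_quot x) * (erf_defect x / 2)"
      using R R0 elim by (intro mult_mono) auto
    hence eig_row: "Im (eig_row 1 x) \<le> - (Re kap * sqrt x / 8)"
      by (simp add: eig_row_def)
    have "Im (amplitude 1 x * cnj (v x)) = Im (P x * cnj (u x)) + Im (eig_row 1 x) * (cmod (v x))\<^sup>2"
    proof -
      have "amplitude 1 x * cnj (v x) = P x * cnj (u x) + eig_row 1 x * of_real ((cmod (v x))\<^sup>2)"
        unfolding amplitude_def qv[symmetric] complex_norm_square by (simp add: algebra_simps)
      thus ?thesis by simp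
    qed
    moreover have "Im (eig_row 1 x) * (cmod (v x))\<^sup>2 \<le> - (Re kap * sqrt x / 8) * (cmod (v x))\<^sup>2"
      using eig_row by (intro mult_right_mono) auto
    moreover have "\<bar>Im (amplitude 1 x * cnj (v x))\<bar> \<le> cmod (amplitude 1 x) * cmod (v x)"
      using abs_Im_le_cmod[of "amplitude 1 x * cnj (v x)"] by (simp add: norm_mult)
    ultimately have *: "(Re kap * sqrt x / 8) * (cmod (v x))\<^sup>2 < cmod (amplitude 1 x) * cmod (v x)"
      using flux_neg[OF elim(3)] by linarith
    have "(Re kap * sqrt x / 8) * (cmod (v x))\<^sup>2 \<ge> 0" using Re_kap elim by simp
    with * have "cmod (amplitude 1 x) * cmod (v x) > 0" by linarith
    hence nz: "amplitude 1 x \<noteq> 0" "cmod (v x) > 0" by auto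
    have "(Re kap * sqrt x / 8) * cmod (v x) < cmod (amplitude 1 x)"
      using * nz(2) by (simp add: power2_eq_square flip: mult.assoc)
    thus ?case using nz Re_kap elim by (simp add: field_simps)
  qed
qed

text \<open>Twice an antiderivative of \<open>x * Im (phase_quot x)\<close>, except that the second
  coefficient is halved: the other half is spent on the remainder term.\<close>

definition growth_exponent :: "real \<Rightarrow> real" where
  "growth_exponent x = 4 / 5 * Im kap * (x\<^sup>2 * sqrt x) + 2 / 3 * (Im kap / (2 * (cmod kap)\<^sup>2)) * (x * sqrt x)"

lemma growth_exponent_deriv: assumes "x > 0"
  shows "(growth_exponent has_real_derivative 2 * Im kap * (x * sqrt x) + (Im kap / (2 * (cmod kap)\<^sup>2)) * sqrt x) (at x)"
proof -
  show ?thesis unfolding growth_exponent_def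
    by (rule DERIV_cong[OF DERIV_add[OF DERIV_cmult DERIV_cmult, 
          OF DERIV_square_mult_sqrt[OF assms] DERIV_mult_sqrt[OF assms]]]) simp
qed

text \<open>The product of \<open>(cmod (amplitude 1 x))\<^sup>2\<close> and
  \<open>exp (- growth_exponent x)\<close> is eventually nondecreasing.\<close>

lemma amplitude_growth: "\<exists>c>0. \<forall>\<^sub>F x in at_top. (cmod (amplitude 1 x))\<^sup>2 \<ge> c * exp (growth_exponent x)"
proof -
  define d where "d = Im kap / (2 * (cmod kap)\<^sup>2)"
  have d: "d > 0" using Im_kap kap_nz by (simp add: d_def)
  \<comment> \<open>By \<open>v_le_amplitude\<close> the remainder changes the logarithmic
    derivative of the squared amplitude by at most \<open>D / sqrt x\<close>, which is eventually
    below \<open>d * sqrt x\<close>.\<close>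
  define D where "D = 2 * (remainder_bd * (8 / Re kap))"
  note remainder_bd = remainder_bd_pos
  have D: "D > 0" using remainder_bd Re_kap by (simp add: D_def)
  have 1: "\<forall>\<^sub>F x in at_top. D / sqrt x \<le> d * sqrt x" using D d by real_asymp
  have "\<forall>\<^sub>F x in at_top. x > 0 \<and> amplitude 1 x \<noteq> 0 \<and> 
    2 * Re (cnj (amplitude 1 x) * (- \<i> * of_real (1 * x) * phase_quot x * amplitude 1 x + remainder 1 x * v x)) \<ge>
    (2 * Im kap * (x * sqrt x) + d * sqrt x) * (cmod (amplitude 1 x))\<^sup>2"
    using 1 v_le_amplitude remainder_bound[of 1, simplified] eventually_gt_at_top[of 0]
  proof eventually_elim
    case (elim x)
    let ?A = "amplitude 1 x" 
    let ?N = "(cmod ?A)\<^sup>2"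
    have "cmod (cnj ?A * (remainder 1 x * v x)) \<le> cmod ?A * (remainder_bd * (8 / (Re kap * sqrt x) * cmod ?A))"
      unfolding norm_mult complex_mod_cnj using elim Re_kap remainder_bd by (intro mult_mono order.refl mult_nonneg_nonneg) auto
    also have "2 * \<dots> = D / sqrt x * ?N" by (simp add: D_def power2_eq_square)
    also have "\<dots> \<le> d * sqrt x * ?N" using elim by (intro mult_right_mono) auto
    finally have a: "2 * Re (cnj ?A * (remainder 1 x * v x)) \<ge> - (d * sqrt x * ?N)"
      using abs_Re_le_cmod[of "cnj ?A * (remainder 1 x * v x)"] by linarith
    have e: "cnj ?A * (- \<i> * of_real (1 * x) * phase_quot x * ?A) = (- \<i> * of_real x * phase_quot x) * of_real ?N"
      unfolding complex_norm_square by (simp add: mult_ac)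
    have b: "Re (cnj ?A * (- \<i> * of_real (1 * x) * phase_quot x * ?A)) = x * Im (phase_quot x) * ?N"
      unfolding e by (simp del: of_real_power)
    have "2 * (x * Im (phase_quot x)) = 2 * Im kap * (x * sqrt x) + 2 * d * (x * inverse (sqrt x))"
      unfolding Im_phase_quot d_def by (simp add: algebra_simps)
    also have "x * inverse (sqrt x) = sqrt x" using mult_inverse_sqrt[of x] elim by simp
    finally have "2 * (x * Im (phase_quot x)) * ?N = (2 * Im kap * (x * sqrt x) + 2 * d * sqrt x) * ?N"
      by simp
    also have "\<dots> = (2 * Im kap * (x * sqrt x) + d * sqrt x) * ?N + d * sqrt x * ?N"
      by (simp add: algebra_simps)
    finally have c: "2 * (x * Im (phase_quot x) * ?N) =
        (2 * Im kap * (x * sqrt x) + d * sqrt x) * ?N + d * sqrt x * ?N"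
      by (simp only: mult.assoc)
    show ?case unfolding distrib_left[of "cnj ?A"] plus_complex.sel b
      using a c elim(2,4) by (auto simp only: distrib_left[of 2])
  qed
  then obtain X where X: "\<And>x. x \<ge> X \<Longrightarrow> x > 0 \<and> amplitude 1 x \<noteq> 0 \<and> 
    2 * Re (cnj (amplitude 1 x) * (- \<i> * of_real (1 * x) * phase_quot x * amplitude 1 x + remainder 1 x * v x)) \<ge>
    (2 * Im kap * (x * sqrt x) + d * sqrt x) * (cmod (amplitude 1 x))\<^sup>2"
    unfolding eventually_at_top_linorder by blast
  define c where "c = (cmod (amplitude 1 X))\<^sup>2 * exp (- growth_exponent X)"
  have c: "c > 0" using X[of X] by (simp add: c_def)
  have "c * exp (growth_exponent x) \<le> (cmod (amplitude 1 x))\<^sup>2" if x: "x \<ge> X" for x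
  proof -
    have "c \<le> (cmod (amplitude 1 x))\<^sup>2 * exp (- growth_exponent x)" unfolding c_def
    proof (rule DERIV_nonneg_imp_nondecreasing[OF x, of "\<lambda>x. (cmod (amplitude 1 x))\<^sup>2 * exp (- growth_exponent x)"])
      fix t assume t: "X \<le> t" "t \<le> x"
      let ?N' = "2 * Re (cnj (amplitude 1 t) * (- \<i> * of_real (1 * t) * phase_quot t * amplitude 1 t + remainder 1 t * v t))"
      let ?h' = "2 * Im kap * (t * sqrt t) + (Im kap / (2 * (cmod kap)\<^sup>2)) * sqrt t"
      have t0: "t > 0" using X[OF t(1)] by simp
      have N: "((\<lambda>x. (cmod (amplitude 1 x))\<^sup>2) has_real_derivative ?N') (at t)"
        by (rule cmod_square_deriv, rule amplitude_deriv) (use t0 in auto)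
      have "((\<lambda>x. exp (- growth_exponent x)) has_real_derivative exp (- growth_exponent t) * (- ?h')) (at t)"
        by (rule DERIV_fun_exp DERIV_minus growth_exponent_deriv t0)+
      from DERIV_mult[OF N this]
      have "((\<lambda>x. (cmod (amplitude 1 x))\<^sup>2 * exp (- growth_exponent x)) has_real_derivative
        (?N' - ?h' * (cmod (amplitude 1 t))\<^sup>2) * exp (- growth_exponent t)) (at t)"
        by (rule DERIV_cong) (simp add: algebra_simps)
      moreover have "(?N' - ?h' * (cmod (amplitude 1 t))\<^sup>2) * exp (- growth_exponent t) \<ge> 0"
        using X[OF t(1)] by (intro mult_nonneg_nonneg) (auto simp: d_def)
      ultimately show "\<exists>y. ((\<lambda>x. (cmod (amplitude 1 x))\<^sup>2 * exp (- growth_exponent x)) has_real_derivative y) (at t) \<and> 0 \<le> y"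
        by (intro exI conjI)
    qed
    thus ?thesis by (simp add: exp_minus field_simps)
  qed
  thus ?thesis using c unfolding eventually_at_top_linorder by blast
qed


text \<open>Recovers \<open>v\<close> from the two amplitudes, so that growth of an amplitude can be
  turned into growth of the solution.\<close>

lemma amplitude_diff: "amplitude (-1) x - amplitude 1 x = \<i> * phase_quot x * of_real (erf_defect x) * v x"
  by (simp add: amplitude_def eig_row_def field_simps)

text \<open>The squared ratio \<open>M\<close> of the decaying to the growing amplitude satisfies
  \<open>M' \<le> - M + D / sqrt x\<close> and tends to 0. The difference of the amplitudes is then
  comparable to the growing one, and dividing by \<open>phase_quot\<close>, of order
  \<open>sqrt x\<close>, costs the factor \<open>1 / x\<close>.\<close>

lemma v_growth: "\<exists>c>0. \<forall>\<^sub>F x in at_top. c * exp (growth_exponent x) / x \<le> (cmod (v x))\<^sup>2"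
proof -
  define k where "k = 8 / Re kap"
  define c0 where "c0 = cmod kap + 1 / (2 * cmod kap)"
  \<comment> \<open>\<open>K\<close> is an a priori bound for
    \<open>cmod (amplitude (-1) x) / cmod (amplitude 1 x)\<close>, from
    \<open>amplitude_diff\<close> and \<open>v_le_amplitude\<close>.\<close>
  define K where "K = 1 + c0 * k"
  define D where "D = 2 * remainder_bd * k * (K + K\<^sup>2)"
  have k: "k > 0" using Re_kap by (simp add: k_def)
  have c0: "c0 > 0" using kap_nz by (simp add: c0_def add_pos_pos)
  have K: "K > 0" using k c0 by (simp add: K_def add_pos_pos)
  note remainder_bd = remainder_bd_pos
  define M where "M = (\<lambda>x. (cmod (amplitude (-1) x))\<^sup>2 / (cmod (amplitude 1 x))\<^sup>2)"
  define A' where "A' = (\<lambda>s x. - \<i> * of_real (s * x) * phase_quot x * amplitude s x + remainder s x * v x)"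
  define N' where "N' = (\<lambda>s x. 2 * Re (cnj (amplitude s x) * A' s x))"
  define M' where "M' = (\<lambda>x. (N' (-1) x * (cmod (amplitude 1 x))\<^sup>2 - (cmod (amplitude (-1) x))\<^sup>2 * N' 1 x) / 
      ((cmod (amplitude 1 x))\<^sup>2 * (cmod (amplitude 1 x))\<^sup>2))"
  have N': "((\<lambda>x. (cmod (amplitude s x))\<^sup>2) has_real_derivative N' s x) (at x)" 
    if "x > 0" "s\<^sup>2 = 1" for s x
    unfolding N'_def A'_def by (rule cmod_square_deriv, rule amplitude_deriv) (use that in auto)
  have N'_near: "\<bar>N' s x - 2 * s * (x * Im (phase_quot x)) * (cmod (amplitude s x))\<^sup>2\<bar> \<le> 2 * (cmod (amplitude s x) * (remainder_bd * cmod (v x)))"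
    if "cmod (remainder s x) \<le> remainder_bd" for s x
  proof -
    have e: "cnj (amplitude s x) * A' s x = (- \<i> * of_real (s * x) * phase_quot x) * of_real ((cmod (amplitude s x))\<^sup>2)
        + cnj (amplitude s x) * (remainder s x * v x)"
      unfolding complex_norm_square A'_def by (simp add: algebra_simps)
    have "N' s x = 2 * s * (x * Im (phase_quot x)) * (cmod (amplitude s x))\<^sup>2 + 2 * Re (cnj (amplitude s x) * (remainder s x * v x))"
      unfolding N'_def e plus_complex.sel mult_of_real_sel by (simp add: mult.assoc)
    moreover have "\<bar>Re (cnj (amplitude s x) * (remainder s x * v x))\<bar> \<le> cmod (amplitude s x) * (remainder_bd * cmod (v x))"
      by (rule order.trans[OF abs_Re_le_cmod], unfold norm_mult complex_mod_cnj)
         (intro mult_mono order.refl that mult_nonneg_nonneg norm_ge_zero less_imp_le[OF remainder_bd])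
    ultimately show ?thesis by linarith
  qed
  have cmp: "\<forall>\<^sub>F x in at_top. x > 0 \<and> amplitude 1 x \<noteq> 0 \<and> cmod (v x) \<le> k / sqrt x * cmod (amplitude 1 x) \<and> 
      cmod (amplitude (-1) x - amplitude 1 x) \<le> c0 * sqrt x * cmod (v x)"
    using v_le_amplitude eventually_ge_at_top[of 1]
  proof eventually_elim
    case (elim x)
    have "0 \<le> erf_defect x" "erf_defect x \<le> 1" using erf_defect_pos[of x] erf_defect_le_1[of x] elim by auto
    hence "cmod (phase_quot x) * erf_defect x * cmod (v x) \<le> c0 * sqrt x * 1 * cmod (v x)"
      using norm_phase_quot_le[of x] elim c0 by (intro mult_mono mult_nonneg_nonneg) (auto simp: c0_def)
    moreover have "cmod (amplitude (-1) x - amplitude 1 x) = cmod (phase_quot x) * erf_defect x * cmod (v x)"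
      using \<open>0 \<le> erf_defect x\<close> unfolding amplitude_diff by (simp add: norm_mult)
    ultimately show ?case using elim by (auto simp: k_def)
  qed
  have "(M \<longlongrightarrow> 0) at_top"
  proof (rule tendsto_0_of_deriv_le)
    show "\<forall>\<^sub>F x in at_top. (M has_real_derivative M' x) (at x)"
      using cmp
    proof eventually_elim
      case (elim x)
      thus ?case unfolding M_def M'_def by (intro DERIV_divide N') auto
    qed
    have ck: "(cmod kap)\<^sup>2 > 0" using kap_nz by simp
    \<comment> \<open>The two eigenvalues make \<open>M\<close> decay at the relative rate
      \<open>4 * g\<close> with \<open>g = x * Im (phase_quot x)\<close>; the threshold 1/4 makes
      this rate at least 1.\<close>
    have "\<forall>\<^sub>F x in at_top. x * (Im kap * (sqrt x + 1 / (2 * (cmod kap)\<^sup>2) * inverse (sqrt x))) \<ge> 1/4"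
      using Im_kap ck by real_asymp
    thus "\<forall>\<^sub>F x in at_top. M' x \<le> - M x + D / sqrt x"
      using cmp remainder_bound[of 1, simplified] remainder_bound[of "-1", simplified]
    proof eventually_elim
      case (elim x)
      define a b g r where "a = cmod (amplitude 1 x)" and "b = cmod (amplitude (-1) x)" and "g = x * Im (phase_quot x)"
        and "r = k / sqrt x"
      have g: "g \<ge> 1/4" using elim unfolding g_def Im_phase_quot by simp
      have a: "a > 0" using elim by (simp add: a_def)
      have b: "b \<ge> 0" by (simp add: b_def)
      have r: "r \<ge> 0" using k elim by (simp add: r_def)
      have v: "cmod (v x) \<le> r * a" using elim by (simp add: a_def r_def)
      have "b \<le> a + c0 * sqrt x * cmod (v x)"
        using elim norm_triangle_sub[of "amplitude (-1) x" "amplitude 1 x"] by (simp add: a_def b_def)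
      also have "\<dots> \<le> a + c0 * sqrt x * (r * a)"
        using v c0 elim by (intro add_left_mono mult_left_mono) auto
      also have "\<dots> = K * a" using elim by (simp add: K_def r_def algebra_simps)
      finally have bK: "b \<le> K * a" .
      have "N' (-1) x \<le> - 2 * g * b\<^sup>2 + 2 * (b * (remainder_bd * cmod (v x)))"
        using N'_near[of "-1" x] elim by (simp add: g_def b_def)
      also have "b * (remainder_bd * cmod (v x)) \<le> K * a * (remainder_bd * (r * a))"
        using bK v a b K remainder_bd by (intro mult_mono) auto
      finally have n1: "N' (-1) x \<le> - 2 * g * b\<^sup>2 + 2 * remainder_bd * K * r * a\<^sup>2"
        by (simp add: power2_eq_square mult_ac)
      have "a * (remainder_bd * cmod (v x)) \<le> a * (remainder_bd * (r * a))"
        using v a remainder_bd by (intro mult_left_mono) auto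
      hence n2: "N' 1 x \<ge> 2 * g * a\<^sup>2 - 2 * remainder_bd * r * a\<^sup>2"
        using N'_near[of 1 x] elim by (simp add: g_def a_def power2_eq_square mult_ac)
      have m: "M x * a\<^sup>2 = b\<^sup>2" "M x = b\<^sup>2 / a\<^sup>2" using a by (simp_all add: M_def a_def b_def)
      have m0: "M x \<ge> 0" by (simp add: M_def)
      have mK: "M x \<le> K\<^sup>2"
        using bK b a power_mono[OF bK b, of 2] by (simp add: m(2) power_mult_distrib field_simps)
      have "M' x = (N' (-1) x - M x * N' 1 x) / a\<^sup>2"
        using a by (simp add: M'_def m(2) a_def[symmetric] b_def[symmetric] field_simps)
      also have "\<dots> \<le> ((- 2 * g * b\<^sup>2 + 2 * remainder_bd * K * r * a\<^sup>2) - M x * (2 * g * a\<^sup>2 - 2 * remainder_bd * r * a\<^sup>2)) / a\<^sup>2"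
        using n1 mult_left_mono[OF n2 m0] by (intro divide_right_mono) auto
      also have "\<dots> = - 4 * g * M x + 2 * remainder_bd * r * (K + M x)"
        unfolding m(1)[symmetric] using a by (simp add: field_simps)
      also have "\<dots> \<le> - M x + 2 * remainder_bd * r * (K + K\<^sup>2)"
      proof (rule add_mono)
        show "- 4 * g * M x \<le> - M x" using mult_right_mono[OF g m0] by simp
        show "2 * remainder_bd * r * (K + M x) \<le> 2 * remainder_bd * r * (K + K\<^sup>2)"
          using mK remainder_bd r by (intro mult_left_mono add_left_mono) auto
      qed
      also have "2 * remainder_bd * r * (K + K\<^sup>2) = D / sqrt x" by (simp add: D_def r_def)
      finally show ?case .
    qed
    show "\<forall>\<^sub>F x in at_top. 0 \<le> M x" by (simp add: M_def)
    show "((\<lambda>x. D / sqrt x) \<longlongrightarrow> 0) at_top" by real_asymp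
  qed
  \<comment> \<open>Below 1/4 the decaying amplitude has less than half the modulus of the growing
    one, so their difference keeps at least the other half.\<close>
  hence M4: "\<forall>\<^sub>F x in at_top. M x < 1 / 4" by (rule order_tendstoD) simp
  obtain c where c: "c > 0" "\<forall>\<^sub>F x in at_top. c * exp (growth_exponent x) \<le> (cmod (amplitude 1 x))\<^sup>2"
    using amplitude_growth by blast
  have "\<forall>\<^sub>F x in at_top. c / (4 * c0\<^sup>2) * exp (growth_exponent x) / x \<le> (cmod (v x))\<^sup>2"
    using cmp M4 c(2)
  proof eventually_elim
    case (elim x)
    define a b where "a = cmod (amplitude 1 x)" and "b = cmod (amplitude (-1) x)"
    have a: "a > 0" using elim by (simp add: a_def)
    have "b\<^sup>2 / a\<^sup>2 < 1 / 4" using elim by (simp add: M_def a_def b_def)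
    hence "b\<^sup>2 < 1 / 4 * a\<^sup>2" using a by (simp only: pos_divide_less_eq zero_less_power)
    hence "b\<^sup>2 < (a / 2)\<^sup>2" by (simp add: power_divide)
    hence "b < a / 2" by (rule power_less_imp_less_base) (use a in simp)
    hence "a / 2 \<le> c0 * sqrt x * cmod (v x)"
      using elim norm_triangle_sub[of "amplitude 1 x" "amplitude (-1) x"] 
        norm_minus_commute[of "amplitude 1 x" "amplitude (-1) x"] unfolding a_def b_def by linarith
    hence "(a / 2)\<^sup>2 \<le> (c0 * sqrt x * cmod (v x))\<^sup>2" using a by (intro power_mono) auto
    hence "a\<^sup>2 \<le> 4 * c0\<^sup>2 * x * (cmod (v x))\<^sup>2"
      using elim by (simp add: power_mult_distrib power_divide)
    hence "c * exp (growth_exponent x) \<le> 4 * c0\<^sup>2 * x * (cmod (v x))\<^sup>2" using elim by (simp add: a_def)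
    moreover have "4 * c0\<^sup>2 * x > 0" using c0 elim by simp
    ultimately have "c * exp (growth_exponent x) / (4 * c0\<^sup>2 * x) \<le> (cmod (v x))\<^sup>2"
      by (simp only: pos_divide_le_eq mult.commute)
    thus ?case by simp
  qed
  moreover have "c / (4 * c0\<^sup>2) > 0" using c c0 by simp
  ultimately show ?thesis by blast
qed

end

section \<open>The Weyl solution\<close>

lemma flux_antimono:
  assumes "solution_pair lam u P" "Im lam > 0" "0 < x" "x \<le> y"
  shows "Im (P y * cnj (u y)) \<le> Im (P x * cnj (u x))"
proof (rule DERIV_nonpos_imp_nonincreasing[OF assms(4), of "\<lambda>x. Im (P x * cnj (u x))"])
  fix t assume "x \<le> t" "t \<le> y"
  with assms have "((\<lambda>x. Im (P x * cnj (u x))) has_real_derivative 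
      - Im lam * (wgt t * (cmod (u t))\<^sup>2)) (at t)"
    by (intro green_identity) auto
  moreover have "- Im lam * (wgt t * (cmod (u t))\<^sup>2) \<le> 0"
    using assms wgt_nonneg[of t] by simp
  ultimately show "\<exists>D. ((\<lambda>x. Im (P x * cnj (u x))) has_real_derivative D) (at t) \<and> D \<le> 0"
    by blast
qed

lemma flux_le_limit:
  assumes "solution_pair lam u P" "Im lam > 0" "0 < x" "((\<lambda>x. Im (P x * cnj (u x))) \<longlongrightarrow> l) (at_right 0)"
  shows "Im (P x * cnj (u x)) \<le> l"
proof (rule tendsto_lowerbound[OF assms(4)])
  show "\<forall>\<^sub>F t in at_right 0. Im (P x * cnj (u x)) \<le> Im (P t * cnj (u t))"
    using assms flux_antimono[OF assms(1,2)] unfolding eventually_at_right_field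
    by (intro exI[of _ x]) auto
qed auto

text \<open>The flux tends to 0 at the origin because \<open>P\<close> does, never increases, and
  strictly decreases near the origin, where \<open>u\<close> has no zero.\<close>

lemma flux_neg_of_limit:
  assumes sol: "solution_pair lam u P" and lam: "Im lam > 0" and u: "(u \<longlongrightarrow> 1) (at_right 0)" and x: "x > 0"
  shows "Im (P x * cnj (u x)) < 0"
proof -
  have lim: "((\<lambda>x. Im (P x * cnj (u x))) \<longlongrightarrow> Im (0 * cnj 1)) (at_right 0)"
    by (intro tendsto_intros u bounded_sol_flux(2)[OF sol u])
  have "\<forall>\<^sub>F t in at_right 0. u t \<noteq> 0" 
    by (rule tendsto_imp_eventually_ne[OF u]) simp
  then obtain d where d: "d > 0" "\<And>t. 0 < t \<Longrightarrow> t < d \<Longrightarrow> u t \<noteq> 0"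
    unfolding eventually_at_right_field by auto
  define t where "t = min (d / 2) x"
  have t: "0 < t" "t < d" "t \<le> x" using d x by (auto simp: t_def)
  have "Im (P t * cnj (u t)) < Im (P (t/2) * cnj (u (t/2)))"
  proof (rule DERIV_neg_imp_decreasing[of "t/2" t "\<lambda>x. Im (P x * cnj (u x))"])
    fix s assume s: "t / 2 \<le> s" "s \<le> t"
    hence "s > 0" "u s \<noteq> 0" using t d(2)[of s] by auto
    hence "- Im lam * (wgt s * (cmod (u s))\<^sup>2) < 0" using lam wgt_pos[of s] by simp
    thus "\<exists>y. ((\<lambda>x. Im (P x * cnj (u x))) has_real_derivative y) (at s) \<and> y < 0"
      using green_identity[OF sol \<open>s > 0\<close>] by blast
  qed (use t in simp)
  also have "\<dots> \<le> 0" using flux_le_limit[OF sol lam _ lim, of "t/2"] t by simp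
  finally show ?thesis using flux_antimono[OF sol lam t(1,3)] by linarith
qed

lemma antimono_converges_at_top:
  fixes J :: "real \<Rightarrow> real"
  assumes anti: "\<And>x y. a < x \<Longrightarrow> x \<le> y \<Longrightarrow> J y \<le> J x" and bd: "\<And>x. a < x \<Longrightarrow> b \<le> J x"
  shows "\<exists>l. (J \<longlongrightarrow> l) at_top"
proof (intro exI order_tendstoI)
  let ?l = "Inf (J ` {a<..})"
  have bdd: "bdd_below (J ` {a<..})" using bd by (auto intro!: bdd_belowI[of _ b])
  fix c assume "c < ?l"
  hence "c < J x" if "x > a" for x
    using cInf_lower[OF _ bdd, of "J x"] that by force
  thus "\<forall>\<^sub>F x in at_top. c < J x" by (rule eventually_mono[OF eventually_gt_at_top[of a]])
next
  let ?l = "Inf (J ` {a<..})"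
  fix c assume "?l < c"
  then obtain x where x: "x > a" "J x < c"
    using cInf_lessD[of "J ` {a<..}" c] by auto
  show "\<forall>\<^sub>F x in at_top. J x < c"
    using eventually_ge_at_top[of x] by eventually_elim (use x anti[of x] in force)
qed

text \<open>By Green's identity \<open>- Im (P x * cnj (u x)) / Im lam\<close> is an antiderivative
  of the nonnegative integrand. It has a limit at 0 by assumption and one at infinity because the
  flux is monotone and bounded below.\<close>

lemma in_weighted_L2_of_flux:
  assumes sol: "solution_pair lam u P" and lam: "Im lam > 0"
    and lim: "((\<lambda>x. Im (P x * cnj (u x))) \<longlongrightarrow> l) (at_right 0)"
    and nonneg: "\<And>x. x > 0 \<Longrightarrow> 0 \<le> Im (P x * cnj (u x))"
  shows "in_weighted_L2 u"
  unfolding in_weighted_L2_def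
proof
  have cont: "isCont u x" if "x > 0" for x using solution_pair_isCont[OF sol that] by simp
  have "continuous_on {0<..} u" using cont by (intro continuous_at_imp_continuous_on) auto
  hence "set_borel_measurable borel {0<..} u" by (intro set_measurable_continuous_on) auto
  thus "set_borel_measurable lborel {0<..} u" by (simp add: set_borel_measurable_def)
  define F where "F = (\<lambda>x. - Im (P x * cnj (u x)) / Im lam)"
  obtain L where L: "((\<lambda>x. Im (P x * cnj (u x))) \<longlongrightarrow> L) at_top"
    using antimono_converges_at_top[of 0 "\<lambda>x. Im (P x * cnj (u x))" 0] flux_antimono[OF sol lam] nonneg
    by blast
  have "set_integrable lborel (einterval 0 \<infinity>) (\<lambda>x. (cmod (u x))\<^sup>2 * wgt x)"
  proof (rule interval_integral_FTC_nonneg)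
    fix x assume x: "(0::ereal) < ereal x"
    hence x0: "x > 0" by simp
    have "(F has_real_derivative - (- Im lam * (wgt x * (cmod (u x))\<^sup>2)) / Im lam) (at x)"
      unfolding F_def by (intro DERIV_cdivide DERIV_minus green_identity[OF sol x0])
    thus "(F has_real_derivative (cmod (u x))\<^sup>2 * wgt x) (at x)"
      using lam by (simp add: mult_ac)
    show "isCont (\<lambda>x. (cmod (u x))\<^sup>2 * wgt x) x"
      unfolding wgt_def using cont[OF x0] by (intro continuous_intros) auto
  next
    show "AE x in lborel. 0 < ereal x \<longrightarrow> ereal x < \<infinity> \<longrightarrow> 0 \<le> (cmod (u x))\<^sup>2 * wgt x"
      by (simp add: wgt_nonneg)
    have "(F \<longlongrightarrow> - l / Im lam) (at_right 0)" unfolding F_def using lam by (intro tendsto_intros lim) auto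
    thus "((F \<circ> real_of_ereal) \<longlongrightarrow> - l / Im lam) (at_right 0)"
      unfolding zero_ereal_def ereal_tendsto_simps .
    have "(F \<longlongrightarrow> - L / Im lam) at_top" unfolding F_def using lam by (intro tendsto_intros L) auto
    thus "((F \<circ> real_of_ereal) \<longlongrightarrow> - L / Im lam) (at_left \<infinity>)"
      unfolding ereal_tendsto_simps .
  qed simp
  thus "set_integrable lborel {0<..} (\<lambda>x. (cmod (u x))\<^sup>2 * wgt x)"
    by (simp add: zero_ereal_def)
qed

text \<open>From \<open>|f - g|^2 \<le> 2 |f|^2 + 2 |g|^2\<close>. Applied to two candidates for the
  Weyl solution, it leaves a multiple of \<open>u1\<close>.\<close>

lemma set_integrable_weighted_diff:
  assumes "in_weighted_L2 f" "in_weighted_L2 g"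
  shows "set_integrable lborel {0<..} (\<lambda>x. (cmod (f x - g x))\<^sup>2 * wgt x)"
proof (rule set_integrable_bound)
  let ?h = "\<lambda>x. 2 * ((cmod (f x))\<^sup>2 * wgt x) + 2 * ((cmod (g x))\<^sup>2 * wgt x)"
  show "set_integrable lborel {0<..} ?h"
    using assms by (intro set_integral_add set_integrable_mult_right) (auto simp: in_weighted_L2_def)
  have m [measurable]: "(\<lambda>x. indicator {0<..} x *\<^sub>R f x) \<in> borel_measurable lborel" 
    "(\<lambda>x. indicator {0<..} x *\<^sub>R g x) \<in> borel_measurable lborel"
    using assms by (auto simp: in_weighted_L2_def set_borel_measurable_def)
  have [measurable]: "wgt \<in> borel_measurable borel" unfolding wgt_def[abs_def] by measurable
  have "(\<lambda>x. (cmod (indicator {0<..} x *\<^sub>R f x - indicator {0<..} x *\<^sub>R g x))\<^sup>2 * wgt x) \<in> borel_measurable lborel"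
    by measurable
  also have "(\<lambda>x. (cmod (indicator {0<..} x *\<^sub>R f x - indicator {0<..} x *\<^sub>R g x))\<^sup>2 * wgt x) =
    (\<lambda>x. indicator {0<..} x *\<^sub>R ((cmod (f x - g x))\<^sup>2 * wgt x))"
    by (auto simp: fun_eq_iff indicator_def)
  finally show "set_borel_measurable lborel {0<..} (\<lambda>x. (cmod (f x - g x))\<^sup>2 * wgt x)"
    by (simp add: set_borel_measurable_def)
  have "norm ((cmod (f x - g x))\<^sup>2 * wgt x) \<le> norm (?h x)" for x
  proof -
    have "(cmod (f x - g x))\<^sup>2 \<le> (cmod (f x) + cmod (g x))\<^sup>2"
      by (intro power_mono norm_triangle_ineq4) auto
    also have "\<dots> \<le> 2 * (cmod (f x))\<^sup>2 + 2 * (cmod (g x))\<^sup>2"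
      using sum_squares_bound[of "cmod (f x)" "cmod (g x)"] by (simp add: power2_sum)
    finally have "(cmod (f x - g x))\<^sup>2 * wgt x \<le> (2 * (cmod (f x))\<^sup>2 + 2 * (cmod (g x))\<^sup>2) * wgt x"
      by (intro mult_right_mono wgt_nonneg)
    thus ?thesis using wgt_nonneg[of x] by (simp add: algebra_simps)
  qed
  thus "AE x in lborel. x \<in> {0<..} \<longrightarrow> norm ((cmod (f x - g x))\<^sup>2 * wgt x) \<le> norm (?h x)"
    by simp
qed

section \<open>Limit-point property and convergence of the quotient\<close>

context growing_solution
begin

lemma u_nonzero: "x > 0 \<Longrightarrow> u x \<noteq> 0"
  using flux_neg[of x] by auto

text \<open>The integrand is \<open>x^2 * (cmod (v x))^2\<close>, at least \<open>c * x\<close> for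
  large \<open>x\<close> by \<open>v_growth\<close>, hence eventually at least 1 on a half-line of
  infinite measure.\<close>

lemma not_square_integrable: "\<not> set_integrable lborel {0<..} (\<lambda>x. (cmod (u x))\<^sup>2 * wgt x)"
proof
  assume int: "set_integrable lborel {0<..} (\<lambda>x. (cmod (u x))\<^sup>2 * wgt x)"
  obtain c where c: "c > 0" "\<forall>\<^sub>F x in at_top. c * exp (growth_exponent x) / x \<le> (cmod (v x))\<^sup>2"
    using v_growth by blast
  have "\<forall>\<^sub>F x in at_top. x > 0 \<and> 1 \<le> (cmod (u x))\<^sup>2 * wgt x"
    using c(2) eventually_ge_at_top[of "1 / c"] eventually_gt_at_top[of 0]
  proof eventually_elim
    case (elim x)
    have "growth_exponent x \<ge> 0" unfolding growth_exponent_def using elim Im_kap by (intro add_nonneg_nonneg mult_nonneg_nonneg) auto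
    hence "c * 1 / x \<le> c * exp (growth_exponent x) / x" using c elim by (intro divide_right_mono mult_left_mono) auto
    hence "x\<^sup>2 * (c * 1 / x) \<le> x\<^sup>2 * (cmod (v x))\<^sup>2" using elim by (intro mult_left_mono) auto
    moreover have "x\<^sup>2 * (c * 1 / x) = x * c" using elim by (simp add: power2_eq_square)
    moreover have "x * c \<ge> 1" using elim c by (simp only: pos_divide_le_eq)
    moreover have "x\<^sup>2 * (cmod (v x))\<^sup>2 = (cmod (u x))\<^sup>2 * wgt x"
    proof -
      have "(exp (- (x\<^sup>2) / 2))\<^sup>2 = exp (- (x\<^sup>2))" by (simp add: power2_eq_square flip: exp_add)
      thus ?thesis by (simp add: v_def wgt_def norm_mult power_mult_distrib)
    qed
    ultimately show ?case using elim by linarith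
  qed
  then obtain X where X: "\<And>x. x \<ge> X \<Longrightarrow> x > 0 \<and> 1 \<le> (cmod (u x))\<^sup>2 * wgt x"
    unfolding eventually_at_top_linorder by blast
  have "set_integrable lborel {X..} (\<lambda>x. (cmod (u x))\<^sup>2 * wgt x)"
    by (rule set_integrable_subset[OF int]) (use X in auto)
  hence "set_integrable lborel {X..} (\<lambda>x. 1::real)"
    by (rule set_integrable_bound) (use X in \<open>force simp: set_borel_measurable_def\<close>)+
  hence "integrable lborel (indicator {X..} :: real \<Rightarrow> real)"
    by (simp add: set_integrable_def)
  hence "emeasure lborel {X..} < \<infinity>" by (subst (asm) integrable_indicator_iff) auto
  then obtain r where r: "r \<ge> 0" "emeasure lborel {X..} = ennreal r"
    by (cases "emeasure lborel {X..}") auto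
  have "ennreal (r + 1) = emeasure lborel {X..X + (r + 1)}" using r by simp
  also have "\<dots> \<le> emeasure lborel {X..}" by (intro emeasure_mono) auto
  also have "\<dots> = ennreal r" by (rule r)
  finally have "r + 1 \<le> r" using r by (subst (asm) ennreal_le_iff) auto
  thus False by simp
qed

lemma ratio_deriv:
  assumes "solution_pair lam f Q" "x > 0"
  shows "((\<lambda>x. f x / u x) has_vector_derivative 
            - (f x * P x - u x * Q x) / (of_real (flux_coeff x) * (u x)\<^sup>2)) (at x)"
proof -
  note nz = u_nonzero[OF assms(2)]
  have "((\<lambda>x. inverse (u x)) has_vector_derivative P x / of_real (flux_coeff x) * (- inverse ((u x)\<^sup>2))) (at x)"
    using field_vector_diff_chain_at[OF solution_pairD(1)[OF sol assms(2)], of inverse "- inverse ((u x)\<^sup>2)"]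
      DERIV_inverse[OF nz] by (simp add: o_def numeral_2_eq_2)
  hence "((\<lambda>x. f x * inverse (u x)) has_vector_derivative 
     f x * (P x / of_real (flux_coeff x) * (- inverse ((u x)\<^sup>2))) + Q x / of_real (flux_coeff x) * inverse (u x)) (at x)"
    by (intro has_vector_derivative_mult solution_pairD(1)[OF assms])
  moreover have "f x * (P x / of_real (flux_coeff x) * (- inverse ((u x)\<^sup>2))) + Q x / of_real (flux_coeff x) * inverse (u x)
     = - (f x * P x - u x * Q x) / (of_real (flux_coeff x) * (u x)\<^sup>2)"
    using nz flux_coeff_pos[OF assms(2)] by (simp add: field_simps power2_eq_square)
  moreover have "(\<lambda>x. f x / u x) = (\<lambda>x. f x * inverse (u x))" by (simp add: divide_inverse)
  ultimately show ?thesis by simp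
qed


text \<open>With Wronskian 1 the derivative of \<open>f / u\<close> has modulus
  \<open>1 / (flux_coeff x * (cmod (u x))^2)\<close>, that is
  \<open>2 * x / (erf_defect x * (cmod (v x))^2)\<close>. It is dominated by the derivative of
  \<open>- g\<close>, so the increments of the quotient are at most those of
  \<open>- g\<close>.\<close>

lemma ratio_limit:
  assumes fQ: "solution_pair lam f Q" and W: "\<And>x. x > 0 \<Longrightarrow> f x * P x - u x * Q x = 1"
  defines "a \<equiv> 4 / 5 * Im kap" and "d \<equiv> Im kap / (2 * (cmod kap)\<^sup>2)"
  shows "\<exists>L. \<forall>\<^sub>F x in at_top. cmod (f x / u x - L) \<le> exp (- (a * (x\<^sup>2 * sqrt x) + d / 3 * (x * sqrt x)))"
proof -
  have a: "a > 0" using Im_kap by (simp add: a_def)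
  have d: "d > 0" using Im_kap kap_nz by (simp add: d_def)
  \<comment> \<open>\<open>growth_exponent\<close> has \<open>2 * d / 3\<close> where
    \<open>g\<close> has \<open>d / 3\<close>; the spare factor
    \<open>exp (- (d / 3 * (x * sqrt x)))\<close> absorbs the powers of \<open>x\<close>.\<close>
  define g where "g = (\<lambda>x. exp (- (a * (x\<^sup>2 * sqrt x) + d / 3 * (x * sqrt x))))"
  define g' where "g' = (\<lambda>x. (5 / 2 * a * (x * sqrt x) + d / 2 * sqrt x) * g x)"
  define R where "R = (\<lambda>x. f x / u x)"
  define R' where "R' = (\<lambda>x. - (f x * P x - u x * Q x) / (of_real (flux_coeff x) * (u x)\<^sup>2))"
  obtain c where c: "c > 0" "\<forall>\<^sub>F x in at_top. c * exp (growth_exponent x) / x \<le> (cmod (v x))\<^sup>2"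
    using v_growth by blast
  have "\<forall>\<^sub>F x in at_top. 4 / c * x\<^sup>2 * exp (- (d / 3 * (x * sqrt x))) \<le> 5 / 2 * a * (x * sqrt x)"
    using a d c(1) by real_asymp
  moreover have "\<forall>\<^sub>F x in at_top. erf_defect x > 1 / 2" using erf_defect_tendsto by (rule order_tendstoD) simp
  ultimately have "\<forall>\<^sub>F x in at_top. x > 0 \<and> cmod (R' x) \<le> g' x"
    using c(2) eventually_gt_at_top[of 0]
  proof eventually_elim
    case (elim x)
    define V where "V = (cmod (v x))\<^sup>2"
    have hg: "exp (- growth_exponent x) = exp (- (d / 3 * (x * sqrt x))) * g x"
      by (simp add: growth_exponent_def g_def a_def d_def field_simps flip: exp_add)
    have V0: "V > 0" using c elim unfolding V_def by (smt (verit) divide_pos_pos exp_gt_zero mult_pos_pos)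
    have "cmod (R' x) = 1 / (flux_coeff x * (cmod (u x))\<^sup>2)"
      unfolding R'_def W[OF elim(4)] using flux_coeff_pos[OF elim(4)] by (simp add: norm_divide norm_mult norm_power)
    also have "flux_coeff x * (cmod (u x))\<^sup>2 = erf_defect x * V / (2 * x)"
    proof -
      have "(exp (- (x\<^sup>2) / 2))\<^sup>2 = exp (- (x\<^sup>2))" by (simp add: power2_eq_square flip: exp_add)
      thus ?thesis using elim by (simp add: flux_coeff_erf_defect V_def v_def norm_mult power_mult_distrib)
    qed
    also have "1 / (erf_defect x * V / (2 * x)) = 2 * x * (1 / erf_defect x) * (1 / V)" by simp
    also have "\<dots> \<le> 2 * x * 2 * (1 / (c * exp (growth_exponent x) / x))"
    proof (intro mult_mono)
      show "1 / erf_defect x \<le> 2" using elim by (simp add: divide_le_eq)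
      show "1 / V \<le> 1 / (c * exp (growth_exponent x) / x)"
        using elim c V0 by (intro divide_left_mono) (auto simp: V_def)
    qed (use elim V0 in auto)
    also have "\<dots> = 4 / c * x\<^sup>2 * exp (- growth_exponent x)" 
      using c by (simp add: exp_minus divide_inverse power2_eq_square)
    also have "\<dots> = 4 / c * x\<^sup>2 * exp (- (d / 3 * (x * sqrt x))) * g x" unfolding hg by simp
    also have "\<dots> \<le> 5 / 2 * a * (x * sqrt x) * g x" 
      using elim by (intro mult_right_mono) (auto simp: g_def)
    also have "\<dots> \<le> g' x" unfolding g'_def using elim d by (intro mult_right_mono) (auto simp: g_def)
    finally show ?case using elim by simp
  qed
  then obtain X where X: "\<And>x. x \<ge> X \<Longrightarrow> x > 0 \<and> cmod (R' x) \<le> g' x"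
    unfolding eventually_at_top_linorder by blast
  have gpos: "g x > 0" for x by (simp add: g_def)
  have ng: "((\<lambda>x. - g x) has_real_derivative g' x) (at x)" if x: "x > 0" for x
  proof -
    have "(g has_real_derivative g x * (- (a * (5 / 2 * (x * sqrt x)) + d / 3 * (3 / 2 * sqrt x)))) (at x)"
      unfolding g_def by (intro DERIV_fun_exp DERIV_minus DERIV_add DERIV_cmult DERIV_mult_sqrt DERIV_square_mult_sqrt x)
    from DERIV_minus[OF this] show ?thesis
      by (rule DERIV_cong) (simp add: g'_def algebra_simps)
  qed
  have diff: "cmod (R y - R x) \<le> g x - g y" if xy: "X \<le> x" "x < y" for x y
  proof -
    have pos: "t > 0" if "x \<le> t" for t using X[of t] xy that by simp
    have dR: "(R has_vector_derivative R' t) (at t)" if "x \<le> t" for t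
      unfolding R_def R'_def by (rule ratio_deriv[OF fQ pos[OF that]])
    have "norm (R y - R x) \<le> - g y - - g x"
    proof (rule differentiable_bound_general[OF xy(2)])
      show "continuous_on {x..y} R"
        using dR by (intro continuous_at_imp_continuous_on ballI has_vector_derivative_continuous) auto
      show "continuous_on {x..y} (\<lambda>x. - g x)"
        using ng pos by (intro continuous_at_imp_continuous_on ballI DERIV_isCont) auto
      fix t assume t: "x < t" "t < y"
      show "(R has_vector_derivative R' t) (at t)" using dR t by simp
      show "((\<lambda>x. - g x) has_vector_derivative g' t) (at t)"
        using ng pos[of t] t by (simp add: has_real_derivative_iff_has_vector_derivative)
      show "norm (R' t) \<le> g' t" using X[of t] xy t by simp
    qed
    thus ?thesis by simp
  qed
  have g0: "(g \<longlongrightarrow> 0) at_top" unfolding g_def using a d by real_asymp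
  have g0s: "(\<lambda>n. g (real n)) \<longlonglongrightarrow> 0"
    by (rule filterlim_compose[OF g0 filterlim_real_sequentially])
  \<comment> \<open>The limit is found along the integers; letting the second point in
    \<open>diff\<close> run through them gives the rate at every real \<open>x\<close>.\<close>
  have "Cauchy (\<lambda>n. R (real n))"
  proof (rule metric_CauchyI)
    fix e :: real assume e: "e > 0"
    have "\<forall>\<^sub>F n in sequentially. g (real n) < e / 2 \<and> real n \<ge> X"
      by (intro eventually_conj order_tendstoD[OF g0s] filterlim_real_sequentially[unfolded filterlim_at_top, rule_format])
         (use e in simp)
    then obtain N where N: "\<And>n. n \<ge> N \<Longrightarrow> g (real n) < e / 2 \<and> real n \<ge> X"
      unfolding eventually_sequentially by blast
    have b: "dist (R (real n)) (R (real N)) < e / 2" if "n \<ge> N" for n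
    proof (cases "n = N")
      case False
      thus ?thesis using diff[of "real N" "real n"] N[of N] that gpos[of "real n"]
        by (simp add: dist_norm)
    qed (use e in simp)
    show "\<exists>M. \<forall>m\<ge>M. \<forall>n\<ge>M. dist (R (real m)) (R (real n)) < e"
      using b by (meson dist_triangle_half_l)
  qed
  then obtain L where L: "(\<lambda>n. R (real n)) \<longlonglongrightarrow> L"
    using Cauchy_convergent_iff convergent_def by blast
  have "cmod (R x - L) \<le> g x" if x: "x \<ge> X" for x
  proof (rule tendsto_upperbound)
    show "(\<lambda>n. cmod (R x - R (real n))) \<longlonglongrightarrow> cmod (R x - L)" by (intro tendsto_intros L)
    have "\<forall>\<^sub>F n in sequentially. real n > x"
      by (rule filterlim_real_sequentially[unfolded filterlim_at_top_dense, rule_format])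
    thus "\<forall>\<^sub>F n in sequentially. cmod (R x - R (real n)) \<le> g x"
    proof eventually_elim
      case (elim n)
      thus ?case using diff[OF x elim] gpos[of "real n"] by (simp add: norm_minus_commute)
    qed
  qed simp
  thus ?thesis unfolding R_def g_def eventually_at_top_linorder by blast
qed

end

section \<open>Identification of the Weyl function and the error estimate\<close>

theorem mainTheorem3:
  fixes lam :: complex and u0 u1 :: "real \<Rightarrow> complex"
  assumes "Re lam > 0" and "Im lam > 0"
    and "is_u0 lam u0" and "is_u1 lam u1"
  shows "\<exists>\<epsilon> :: real \<Rightarrow> complex.
     \<epsilon> \<in> o[at_top](\<lambda>x. of_real (exp (- Im (4 * csqrt (2 * lam) / 5) * x powr (5 / 2)))) \<and>
     (\<forall>\<^sub>F x in at_top. y_of u1 x \<noteq> 0 \<and>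
        y_of u0 x / y_of u1 x = - weyl_m u0 u1 * (1 + \<epsilon> x))"
proof -
  note lam = assms(2)
  define P0 P1 where "P0 = (\<lambda>x. of_real (flux_coeff x) * vector_derivative u0 (at x))"
    and "P1 = (\<lambda>x. of_real (flux_coeff x) * vector_derivative u1 (at x))"
  have sol0: "solution_pair lam u0 P0" and sol1: "solution_pair lam u1 P1"
    using assms(3,4) unfolding P0_def P1_def is_u0_def is_u1_def by (auto intro: is_solution_imp_solution_pair)
  have u1: "(u1 \<longlongrightarrow> 1) (at_right 0)" using assms(4) by (simp add: is_u1_def)
  note at0 = u0_at_0(1,2)[OF assms(3), folded P0_def]
  have Im_P0_u0: "((\<lambda>x. Im (P0 x * cnj (u0 x))) \<longlongrightarrow> 0) (at_right 0)"
    unfolding P0_def by (rule u0_at_0(3)[OF assms(3)])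
  note P1 = bounded_sol_flux[OF sol1 u1]
  interpret growing_solution lam u1 P1
    using sol1 lam flux_neg_of_limit[OF sol1 lam u1] by unfold_locales auto

  \<comment> \<open>\<open>u0\<close> blows up like \<open>1 / x\<close>, so the factor
    \<open>x\<close> is moved from \<open>P1\<close> to \<open>u0\<close> to obtain two convergent
    factors.\<close>
  have xP1: "((\<lambda>x. (of_real x * u0 x) * (P1 x / of_real x)) \<longlongrightarrow> of_real (3 * sqrt pi / 2) * 0) (at_right 0)"
    by (intro tendsto_intros at0 P1)
  have ev: "\<forall>\<^sub>F x in at_right 0. (of_real x * u0 x) * (P1 x / of_real x) = u0 x * P1 x"
    using eventually_at_right_less[of 0] by eventually_elim simp
  have u0P1: "((\<lambda>x. u0 x * P1 x) \<longlongrightarrow> 0) (at_right 0)"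
    using xP1 tendsto_cong[OF ev] by simp
  have W: "u0 x * P1 x - u1 x * P0 x = 1" if x: "x > 0" for x
  proof -
    have "((\<lambda>t. u0 t * P1 t - u1 t * P0 t) \<longlongrightarrow> 0 - 1 * (-1)) (at_right 0)"
      by (intro tendsto_intros u0P1 u1 at0)
    moreover have "\<forall>\<^sub>F t in at_right 0. u0 t * P1 t - u1 t * P0 t = u0 x * P1 x - u1 x * P0 x"
      using eventually_at_right_less[of 0] 
      by eventually_elim (use wronskian_const[OF sol0 sol1 _ x] in simp)
    ultimately have "((\<lambda>t. u0 x * P1 x - u1 x * P0 x) \<longlongrightarrow> 1) (at_right (0::real))"
      by (simp add: tendsto_cong)
    thus ?thesis by (simp add: tendsto_const_iff)
  qed

  define psi Q J where "psi = (\<lambda>m x. u0 x + m * u1 x)" and "Q = (\<lambda>m x. P0 x + m * P1 x)"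
    and "J = (\<lambda>m x. Im (Q m x * cnj (psi m x)))"
  have sol_psi: "solution_pair lam (psi m) (Q m)" for m
    unfolding psi_def Q_def by (rule solution_pair_add_mult[OF sol0 sol1])
  \<comment> \<open>The product \<open>P0 * cnj u0\<close> is unbounded and enters only through its
    imaginary part, which tends to 0. The mixed term \<open>P1 * cnj u0\<close> has the modulus of
    \<open>u0 * P1\<close>, and \<open>P0 * cnj m * cnj u1\<close> tends to \<open>- cnj m\<close>,
    which contributes \<open>Im m\<close>.\<close>
  have J0: "(J m \<longlongrightarrow> Im m) (at_right 0)" for m
  proof -
    have r: "((\<lambda>x. Im (P0 x * cnj m * cnj (u1 x)) 
        + Im (m * cnj (cnj (P1 x) * u0 x)) + Im (m * P1 x * cnj m * cnj (u1 x))) 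
      \<longlongrightarrow> Im (-1 * cnj m * cnj 1) + Im (m * cnj 0) + Im (m * 0 * cnj m * cnj 1)) (at_right 0)"
    proof (intro tendsto_intros at0 u1 P1)
      show "((\<lambda>x. cnj (P1 x) * u0 x) \<longlongrightarrow> 0) (at_right 0)"
      proof (rule tendsto_norm_zero_cancel)
        show "((\<lambda>x. cmod (cnj (P1 x) * u0 x)) \<longlongrightarrow> 0) (at_right 0)"
          using tendsto_norm_zero[OF u0P1] by (simp add: norm_mult mult.commute)
      qed
    qed
    have eq: "J m = (\<lambda>x. Im (P0 x * cnj (u0 x)) + (Im (P0 x * cnj m * cnj (u1 x)) 
        + Im (m * cnj (cnj (P1 x) * u0 x)) + Im (m * P1 x * cnj m * cnj (u1 x))))"
      unfolding J_def Q_def psi_def by (simp add: fun_eq_iff algebra_simps)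
    show ?thesis unfolding eq by (rule tendsto_eq_rhs[OF tendsto_add[OF Im_P0_u0 r]]) simp
  qed

  define a d where "a = 4 / 5 * Im kap" and "d = Im kap / (2 * (cmod kap)\<^sup>2)"
  have a: "a > 0" using Im_kap by (simp add: a_def)
  have d: "d > 0" using Im_kap kap_nz by (simp add: d_def)
  define g where "g = (\<lambda>x. exp (- (a * (x\<^sup>2 * sqrt x) + d / 3 * (x * sqrt x))))"
  obtain L where L: "\<forall>\<^sub>F x in at_top. cmod (u0 x / u1 x - L) \<le> g x"
    using ratio_limit[OF sol0 W] unfolding g_def a_def d_def by blast
  have g0: "(g \<longlongrightarrow> 0) at_top" unfolding g_def using a d by real_asymp
  have "((\<lambda>x. u0 x / u1 x - L) \<longlongrightarrow> 0) at_top" by (rule Lim_null_comparison[OF L g0])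
  hence RL: "((\<lambda>x. u0 x / u1 x) \<longlongrightarrow> L) at_top" by (simp add: LIM_zero_iff)

  text \<open>The solution that vanishes at \<open>X\<close> has nonnegative flux on \<open>(0, X)\<close>; let \<open>X \<rightarrow> \<infinity>\<close>.\<close>
  have J_nonneg: "0 \<le> J (- L) x" if x: "x > 0" for x
  proof (rule tendsto_lowerbound)
    show "((\<lambda>X. J (- (u0 X / u1 X)) x) \<longlongrightarrow> J (- L) x) at_top"
      unfolding J_def Q_def psi_def by (intro tendsto_intros RL)
    show "\<forall>\<^sub>F X in at_top. 0 \<le> J (- (u0 X / u1 X)) x"
      using eventually_ge_at_top[of x]
    proof eventually_elim
      case (elim X)
      hence "psi (- (u0 X / u1 X)) X = 0" using u_nonzero[of X] x by (simp add: psi_def)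
      hence "J (- (u0 X / u1 X)) X = 0" by (simp add: J_def)
      thus ?case using flux_antimono[OF sol_psi lam x elim, of "- (u0 X / u1 X)"] by (simp add: J_def)
    qed
  qed simp
  have L2: "in_weighted_L2 (\<lambda>x. u0 x + - L * u1 x)"
    using in_weighted_L2_of_flux[OF sol_psi lam J0[unfolded J_def], of "- L"] J_nonneg
    unfolding J_def psi_def by blast
  \<comment> \<open>Two admissible values would make a nonzero multiple of \<open>u1\<close> square
    integrable.\<close>
  have unique: "m = - L" if "in_weighted_L2 (\<lambda>x. u0 x + m * u1 x)" for m
  proof (rule ccontr)
    assume "m \<noteq> - L"
    hence nz: "m + L \<noteq> 0" by (simp add: add_eq_0_iff2)
    have "(\<lambda>x. (cmod ((u0 x + m * u1 x) - (u0 x + - L * u1 x)))\<^sup>2 * wgt x) =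
      (\<lambda>x. (cmod (m + L))\<^sup>2 * ((cmod (u1 x))\<^sup>2 * wgt x))"
      by (auto simp: fun_eq_iff norm_mult power_mult_distrib simp flip: distrib_right)
    hence "set_integrable lborel {0<..} (\<lambda>x. (cmod (m + L))\<^sup>2 * ((cmod (u1 x))\<^sup>2 * wgt x))"
      using set_integrable_weighted_diff[OF that L2] by simp
    hence "set_integrable lborel {0<..} (\<lambda>x. (cmod (u1 x))\<^sup>2 * wgt x)"
      using nz by (subst (asm) set_integrable_mult_right_iff) auto
    thus False using not_square_integrable by simp
  qed
  have m: "weyl_m u0 u1 = - L"
    unfolding weyl_m_def
  proof (rule the_equality)
    show "in_weighted_L2 (\<lambda>x. u0 x + - L * u1 x)" by (rule L2)
  qed (rule unique)

  \<comment> \<open>A relative error requires division by \<open>L\<close>. If \<open>L\<close> were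
    0, the flux of \<open>u0\<close> would lie between 0 and its limit 0 at the origin; Green's
    identity would then give \<open>u0 = 0\<close>, against the nonzero limit of
    \<open>x * u0 x\<close>.\<close>
  have L_nz: "L \<noteq> 0"
  proof
    assume "L = 0"
    have "J 0 x = 0" if "x > 0" for x
      using J_nonneg[OF that] flux_le_limit[OF sol_psi lam that J0[unfolded J_def], of 0] \<open>L = 0\<close>
      by (simp add: J_def)
    hence Jz: "Im (P0 x * cnj (u0 x)) = 0" if "x > 0" for x
      using that by (simp add: J_def Q_def psi_def)
    have "u0 x = 0" if x: "x > 0" for x
    proof -
      have "((\<lambda>x. Im (P0 x * cnj (u0 x))) has_real_derivative 0) (at x)"
        by (rule has_field_derivative_transform_within_open[where S = "{0<..}" and f = "\<lambda>_. 0"])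
           (use Jz x in auto)
      hence "- Im lam * (wgt x * (cmod (u0 x))\<^sup>2) = 0"
        using green_identity[OF sol0 x] DERIV_unique by blast
      thus ?thesis using lam wgt_pos[OF x] by simp
    qed
    hence u0z: "\<And>x. x > 0 \<Longrightarrow> of_real x * u0 x = 0" by simp
    have "\<forall>\<^sub>F x in at_right 0. of_real x * u0 x = 0"
      using eventually_at_right_less[of 0] by eventually_elim (rule u0z)
    from tendsto_cong[OF this] have "((\<lambda>x::real. 0 :: complex) \<longlongrightarrow> of_real (3 * sqrt pi / 2)) (at_right 0)"
      using at0(1) by blast
    thus False by (simp add: tendsto_const_iff)
  qed

  define eps where "eps = (\<lambda>x. u0 x / u1 x / L - 1)"
  show ?thesis
  proof (intro exI[of _ eps] conjI)
    have "\<forall>\<^sub>F x in at_top. y_of u1 x \<noteq> 0 \<and> y_of u0 x / y_of u1 x = L * (1 + eps x)"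
      using eventually_gt_at_top[of 0]
      by eventually_elim (use u_nonzero L_nz in \<open>simp add: y_of_def eps_def\<close>)
    thus "\<forall>\<^sub>F x in at_top. y_of u1 x \<noteq> 0 \<and> y_of u0 x / y_of u1 x = - weyl_m u0 u1 * (1 + eps x)"
      by (simp add: m)
    show "eps \<in> o[at_top](\<lambda>x. of_real (exp (- Im (4 * csqrt (2 * lam) / 5) * x powr (5 / 2))))"
    proof (rule landau_o.smallI)
      fix c :: real assume c: "c > 0"
      \<comment> \<open>This decaying factor of \<open>g\<close>, left beside the leading
        exponential, turns the bound into a little o.\<close>
      have "((\<lambda>x. exp (- (d / 3 * (x * sqrt x)))) \<longlongrightarrow> 0) at_top" using d by real_asymp
      hence "\<forall>\<^sub>F x in at_top. exp (- (d / 3 * (x * sqrt x))) < c * cmod L"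
        by (rule order_tendstoD) (use c L_nz in simp)
      thus "\<forall>\<^sub>F x in at_top. norm (eps x) \<le> c * norm (complex_of_real 
          (exp (- Im (4 * csqrt (2 * lam) / 5) * x powr (5 / 2))))"
        using L eventually_gt_at_top[of 0]
      proof eventually_elim
        case (elim x)
        have "x powr (5 / 2) = x powr (2 + 1 / 2)" by simp
        also have "\<dots> = x\<^sup>2 * sqrt x" using elim unfolding powr_add
          by (simp add: powr_half_sqrt)
        finally have t: "exp (- Im (4 * csqrt (2 * lam) / 5) * x powr (5 / 2)) = exp (- (a * (x\<^sup>2 * sqrt x)))"
          by (simp add: a_def kap_def)
        have "eps x = (u0 x / u1 x - L) / L" using L_nz by (simp add: eps_def diff_divide_distrib)
        hence "norm (eps x) = cmod (u0 x / u1 x - L) / cmod L" by (simp add: norm_divide)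
        also have "\<dots> \<le> g x / cmod L" using elim by (intro divide_right_mono) auto
        also have "g x = exp (- (d / 3 * (x * sqrt x))) * exp (- (a * (x\<^sup>2 * sqrt x)))"
          by (simp add: g_def flip: exp_add)
        also have "\<dots> / cmod L \<le> (c * cmod L) * exp (- (a * (x\<^sup>2 * sqrt x))) / cmod L"
          using elim by (intro divide_right_mono mult_right_mono) auto
        also have "\<dots> = c * exp (- (a * (x\<^sup>2 * sqrt x)))" using L_nz by simp
        finally show ?case unfolding t by simp
      qed
    qed
  qed
qed

end
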